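(* Let $\lambda$ and $\mu$ be mutually absolutely continuous sigma-finite measures on a measurable space $(S,\mathcal S)$, and let $P_\lambda,P_\mu$ be the Poisson PP distributions with intensity measures $\lambda,\mu$. Then $P_\lambda$ and $P_\mu$ are either mutually absolutely continuous or mutually singular, according to $H(\lambda,\mu)$ being finite or infinite; that is, if $H(\lambda,\mu)<\infty$ then $P_\lambda\ll P_\mu$ and $P_\mu\ll P_\lambda$, and if $H(\lambda,\mu)=\infty$ then $P_\lambda\perp P_\mu$.
   Context: Point patterns: $N(S)$ is the set of measures on $(S,\mathcal S)$ that can be written as a countable sum of integer-valued finite measures, equipped with the sigma-algebra $\mathcal N(S)$ generated by the evaluation maps $\eta\mapsto\eta(B)$, $B\in\mathcal S$. Poisson PP distribution: for a sigma-finite measure $\lambda$ on $(S,\mathcal S)$, $P_\lambda$ is the unique probability measure on $(N(S),\mathcal N(S))$ under which $\eta(B_1),\dots,\eta(B_n)$ are independent for all $n\ge1$ and mutually disjoint $B_1,\dots,B_n\in\mathcal S$, and $\eta(B)$ is Poisson distributed with mean $\lambda(B)$ for every $B\in\mathcal S$ (with $\mathrm{Poi}(0)=\delta_0$, $\mathrm{Poi}(\infty)=\delta_\infty$). Hellinger distance of sigma-finite measures: $H(\lambda,\mu)=\left(\frac12\int_S(\sqrt f-\sqrt g)^2\,d\nu\right)^{1/2}\in[0,\infty]$, where $f,g$ are densities of $\lambda,\mu$ with respect to a sigma-finite measure $\nu$ (the value does not depend on the choice). *)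

theory Defs
  imports "HOL-Probability.Probability"
begin

definition point_patterns :: "'a measure \<Rightarrow> 'a measure set" where
  "point_patterns S = {\<eta>. sets \<eta> = sets S \<and>
     (\<exists>m :: nat \<Rightarrow> 'a measure.
        (\<forall>i. sets (m i) = sets S \<and> finite_measure (m i) \<and>
             (\<forall>B\<in>sets S. emeasure (m i) B \<in> range of_nat)) \<and>
        (\<forall>B\<in>sets S. emeasure \<eta> B = (\<Sum>i. emeasure (m i) B)))}"

text \<open>
  The sigma-algebra generated by the evaluation maps, rendered as for \<^const>\<open>subprob_algebra\<close>.
\<close>

definition pp_algebra :: "'a measure \<Rightarrow> 'a measure measure" where
  "pp_algebra S =
     (SUP B \<in> sets S. vimage_algebra (point_patterns S) (\<lambda>\<eta>. emeasure \<eta> B) borel)"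

lemma space_pp_algebra: "space (pp_algebra S) = point_patterns S"
  by (auto simp add: pp_algebra_def space_Sup_eq_UN)

lemma measurable_emeasure_pp_algebra [measurable]:
  "B \<in> sets S \<Longrightarrow> (\<lambda>\<eta>. emeasure \<eta> B) \<in> borel_measurable (pp_algebra S)"
  by (auto intro!: measurable_Sup1 measurable_vimage_algebra1 simp: pp_algebra_def)

text \<open>
  The case distinction is needed because \<^const>\<open>poisson_pmf\<close> is specified for strictly
  positive finite rates only.
\<close>

definition poisson_law :: "ennreal \<Rightarrow> ennreal measure" where
  "poisson_law m =
     (if m = 0 then return borel 0
      else if m = \<infinity> then return borel \<infinity>
      else distr (measure_pmf (poisson_pmf (enn2real m))) borel of_nat)"

definition poisson_pp :: "'a measure \<Rightarrow> 'a measure \<Rightarrow> 'a measure measure \<Rightarrow> bool" where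
  "poisson_pp S \<Lambda> P \<longleftrightarrow>
     prob_space P \<and> sets P = sets (pp_algebra S) \<and>
     (\<forall>n\<ge>1. \<forall>B :: nat \<Rightarrow> 'a set. B ` {..<n} \<subseteq> sets S \<longrightarrow> disjoint_family_on B {..<n} \<longrightarrow>
        prob_space.indep_vars P (\<lambda>_. borel) (\<lambda>i \<eta>. emeasure \<eta> (B i)) {..<n}) \<and>
     (\<forall>B\<in>sets S. distr P borel (\<lambda>\<eta>. emeasure \<eta> B) = poisson_law (emeasure \<Lambda> B))"

definition mutually_singular :: "'b measure \<Rightarrow> 'b measure \<Rightarrow> bool" where
  "mutually_singular P Q \<longleftrightarrow>
     sets P = sets Q \<and> (\<exists>A\<in>sets P. emeasure P A = 0 \<and> emeasure Q (space Q - A) = 0)"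

definition ennreal_sqrt :: "ennreal \<Rightarrow> ennreal" where
  "ennreal_sqrt x = (if x = \<infinity> then \<infinity> else ennreal (sqrt (enn2real x)))"

definition is_density :: "'a measure \<Rightarrow> 'a measure \<Rightarrow> ('a \<Rightarrow> real) \<Rightarrow> bool" where
  "is_density \<nu> \<Lambda> f \<longleftrightarrow>
     f \<in> borel_measurable \<nu> \<and> (\<forall>x\<in>space \<nu>. 0 \<le> f x) \<and> \<Lambda> = density \<nu> (\<lambda>x. ennreal (f x))"

definition hellinger_via :: "'a measure \<Rightarrow> ('a \<Rightarrow> real) \<Rightarrow> ('a \<Rightarrow> real) \<Rightarrow> ennreal" where
  "hellinger_via \<nu> f g =
     ennreal_sqrt (1 / 2 * (\<integral>\<^sup>+x. ennreal ((sqrt (f x) - sqrt (g x))\<^sup>2) \<partial>\<nu>))"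

text \<open>
  The distance is the common value of \<^const>\<open>hellinger_via\<close> over all choices of dominating
  measure and densities; \<open>hellinger_eq\<close> and \<open>hellinger_densities_exist\<close> below show that the
  description is well defined for sigma-finite measures.
\<close>

definition hellinger :: "'a measure \<Rightarrow> 'a measure \<Rightarrow> ennreal" where
  "hellinger \<Lambda> \<mu> = (THE h. \<exists>\<nu> f g. sigma_finite_measure \<nu> \<and>
      is_density \<nu> \<Lambda> f \<and> is_density \<nu> \<mu> g \<and> h = hellinger_via \<nu> f g)"

lemma sigma_finite_dominating:
  fixes M N :: "'a measure"
  assumes "sigma_finite_measure M" "sigma_finite_measure N" "sets N = sets M"
  obtains R where "sigma_finite_measure R" "sets R = sets M"
    "absolutely_continuous R M" "absolutely_continuous R N"
proof -
  interpret M: sigma_finite_measure M by fact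
  interpret N: sigma_finite_measure N by fact
  have sp: "space N = space M" using assms(3) by (rule sets_eq_imp_space_eq)
  obtain h where h: "h \<in> borel_measurable M" "integral\<^sup>N M h \<noteq> \<infinity>"
    "\<And>x. x \<in> space M \<Longrightarrow> 0 < h x \<and> h x < \<infinity>"
    using M.Ex_finite_integrable_function by auto
  obtain k where k: "k \<in> borel_measurable N" "integral\<^sup>N N k \<noteq> \<infinity>"
    "\<And>x. x \<in> space N \<Longrightarrow> 0 < k x \<and> k x < \<infinity>"
    using N.Ex_finite_integrable_function by auto
  define R where "R = measure_of (space M) (sets M)
    (\<lambda>A. emeasure (density M h) A + emeasure (density N k) A)"
  have setsR: "sets R = sets M" by (simp add: R_def)
  have spR: "space R = space M" by (simp add: R_def)
  have emR: "emeasure R A = emeasure (density M h) A + emeasure (density N k) A"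
    if A: "A \<in> sets M" for A
    unfolding R_def
  proof (rule emeasure_measure_of_sigma)
    show "sigma_algebra (space M) (sets M)" by (rule sets.sigma_algebra_axioms)
    show "positive (sets M) (\<lambda>A. emeasure (density M h) A + emeasure (density N k) A)"
      by (simp add: positive_def)
    show "countably_additive (sets M) (\<lambda>A. emeasure (density M h) A + emeasure (density N k) A)"
    proof (rule countably_additiveI)
      fix A :: "nat \<Rightarrow> 'a set"
      assume *: "range A \<subseteq> sets M" "disjoint_family A"
      have "(\<Sum>i. emeasure (density M h) (A i)) = emeasure (density M h) (\<Union>i. A i)"
        using * by (intro suminf_emeasure) auto
      moreover have "(\<Sum>i. emeasure (density N k) (A i)) = emeasure (density N k) (\<Union>i. A i)"
        using * assms(3) by (intro suminf_emeasure) auto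
      ultimately show "(\<Sum>i. emeasure (density M h) (A i) + emeasure (density N k) (A i)) =
          emeasure (density M h) (\<Union>i. A i) + emeasure (density N k) (\<Union>i. A i)"
        by (simp add: suminf_add[symmetric])
    qed
    show "A \<in> sets M" by (rule A)
  qed
  have fin: "emeasure R (space R) \<noteq> \<infinity>"
  proof -
    have "emeasure (density M h) (space M) = integral\<^sup>N M h"
      using h(1) by (simp add: emeasure_density cong: nn_integral_cong)
    moreover have "emeasure (density N k) (space M) = integral\<^sup>N N k"
      using k(1) sp[symmetric] by (simp add: emeasure_density cong: nn_integral_cong)
    ultimately show ?thesis using h(2) k(2) by (simp add: spR emR)
  qed
  interpret R: finite_measure R by standard (use fin in simp)
  have "absolutely_continuous R M"
    unfolding absolutely_continuous_def
  proof
    fix A assume "A \<in> null_sets R"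
    then have A: "A \<in> sets M" "A \<in> null_sets (density M h)"
      using setsR emR[of A] by (auto simp: null_sets_def)
    then have "AE x in M. x \<in> A \<longrightarrow> h x = 0"
      using h(1) by (simp add: null_sets_density_iff)
    then have "AE x in M. x \<notin> A"
      using AE_space by eventually_elim (use h(3) in force)
    then show "A \<in> null_sets M" using A(1) by (simp add: AE_iff_null_sets)
  qed
  moreover have "absolutely_continuous R N"
    unfolding absolutely_continuous_def
  proof
    fix A assume "A \<in> null_sets R"
    then have A: "A \<in> sets N" "A \<in> null_sets (density N k)"
      using setsR emR[of A] assms(3) by (auto simp: null_sets_def)
    then have "AE x in N. x \<in> A \<longrightarrow> k x = 0"
      using k(1) by (simp add: null_sets_density_iff)
    then have "AE x in N. x \<notin> A"
      using AE_space by eventually_elim (use k(3) in force)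
    then show "A \<in> null_sets N" using A(1) by (simp add: AE_iff_null_sets)
  qed
  ultimately show ?thesis
    using that[of R] R.sigma_finite_measure_axioms setsR by blast
qed

lemma is_density_exists:
  assumes "sigma_finite_measure R" "sigma_finite_measure M" "sets M = sets R"
    "absolutely_continuous R M"
  shows "\<exists>f. is_density R M f"
proof -
  interpret R: sigma_finite_measure R by fact
  have "AE x in R. RN_deriv R M x \<noteq> \<infinity>"
    using R.RN_deriv_finite assms by blast
  then have "density R (RN_deriv R M) = density R (\<lambda>x. ennreal (enn2real (RN_deriv R M x)))"
    by (intro density_cong) (auto simp: top.not_eq_extremum elim!: eventually_mono)
  moreover have "density R (RN_deriv R M) = M"
    using assms by (intro R.density_RN_deriv) auto
  ultimately have "is_density R M (\<lambda>x. enn2real (RN_deriv R M x))"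
    by (simp add: is_density_def)
  then show ?thesis by blast
qed

lemma is_densityD_sets: "is_density R M f \<Longrightarrow> sets M = sets R"
  by (simp add: is_density_def)

lemma is_densityD_measurable:
  assumes "is_density R M f" "sets R = sets N"
  shows "f \<in> borel_measurable N"
proof -
  have "f \<in> borel_measurable R" using assms(1) by (simp add: is_density_def)
  then show ?thesis by (simp only: measurable_cong_sets[OF assms(2) refl])
qed

lemma is_densityD_nonneg:
  assumes "is_density R M f" "sets R = sets N" "x \<in> space N"
  shows "0 \<le> f x"
  using assms sets_eq_imp_space_eq[OF assms(2)] by (simp add: is_density_def)

lemma is_densityD_eq: "is_density R M f \<Longrightarrow> M = density R (\<lambda>x. ennreal (f x))"
  by (simp add: is_density_def)

lemma hellinger_densities_exist:
  assumes "sigma_finite_measure \<Lambda>" "sigma_finite_measure \<mu>" "sets \<mu> = sets \<Lambda>"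
  shows "\<exists>\<nu> f g. sigma_finite_measure \<nu> \<and> is_density \<nu> \<Lambda> f \<and> is_density \<nu> \<mu> g"
proof -
  obtain R where "sigma_finite_measure R" "sets R = sets \<Lambda>"
    "absolutely_continuous R \<Lambda>" "absolutely_continuous R \<mu>"
    using sigma_finite_dominating[OF assms] by blast
  then show ?thesis
    using is_density_exists[of R \<Lambda>] is_density_exists[of R \<mu>] assms by metis
qed

lemma hellinger_via_unique:
  assumes "sigma_finite_measure \<nu>1" "is_density \<nu>1 \<Lambda> f1" "is_density \<nu>1 \<mu> g1"
    and "sigma_finite_measure \<nu>2" "is_density \<nu>2 \<Lambda> f2" "is_density \<nu>2 \<mu> g2"
  shows "hellinger_via \<nu>1 f1 g1 = hellinger_via \<nu>2 f2 g2"
proof -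
  have s: "sets \<nu>1 = sets \<Lambda>" "sets \<nu>2 = sets \<Lambda>"
    using is_densityD_sets[OF assms(2)] is_densityD_sets[OF assms(5)] by simp_all
  obtain R where R: "sigma_finite_measure R" "sets R = sets \<nu>1"
    "absolutely_continuous R \<nu>1" "absolutely_continuous R \<nu>2"
    using sigma_finite_dominating[OF assms(1,4)] s by auto
  interpret R: sigma_finite_measure R by fact
  have chg: "\<exists>h. h \<in> borel_measurable R \<and>
      (\<forall>x\<in>space R. 0 \<le> h x) \<and>
      \<Lambda> = density R (\<lambda>x. ennreal (h x * f x)) \<and> \<mu> = density R (\<lambda>x. ennreal (h x * g x)) \<and>
      (\<integral>\<^sup>+x. ennreal ((sqrt (f x) - sqrt (g x))\<^sup>2) \<partial>\<nu>) =
      (\<integral>\<^sup>+x. ennreal ((sqrt (h x * f x) - sqrt (h x * g x))\<^sup>2) \<partial>R)"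
    if \<nu>: "sigma_finite_measure \<nu>" "is_density \<nu> \<Lambda> f" "is_density \<nu> \<mu> g" "sets \<nu> = sets R"
      "absolutely_continuous R \<nu>" for \<nu> f g
  proof -
    obtain h where h: "is_density R \<nu> h"
      using is_density_exists[of R \<nu>] R \<nu> by auto
    have h0: "0 \<le> h x" if "x \<in> space R" for x using is_densityD_nonneg[OF h refl that] .
    have [measurable]: "h \<in> borel_measurable R" "f \<in> borel_measurable R" "g \<in> borel_measurable R"
      using is_densityD_measurable[OF h refl] is_densityD_measurable[OF \<nu>(2,4)]
        is_densityD_measurable[OF \<nu>(3,4)] by blast+
    have eq: "\<nu> = density R (\<lambda>x. ennreal (h x))" using is_densityD_eq[OF h] .
    have d: "density \<nu> (\<lambda>x. ennreal (u x)) = density R (\<lambda>x. ennreal (h x * u x))"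
      if [measurable]: "u \<in> borel_measurable R" and u: "\<forall>x\<in>space R. 0 \<le> u x" for u
    proof -
      have "density \<nu> (\<lambda>x. ennreal (u x)) = density R (\<lambda>x. ennreal (h x) * ennreal (u x))"
        unfolding eq by (subst density_density_eq) auto
      also have "\<dots> = density R (\<lambda>x. ennreal (h x * u x))"
        by (intro density_cong) (auto simp: ennreal_mult h0 u)
      finally show ?thesis .
    qed
    have f0: "\<forall>x\<in>space R. 0 \<le> f x" and g0: "\<forall>x\<in>space R. 0 \<le> g x"
      using is_densityD_nonneg[OF \<nu>(2,4)] is_densityD_nonneg[OF \<nu>(3,4)] by blast+
    have "(\<integral>\<^sup>+x. ennreal ((sqrt (f x) - sqrt (g x))\<^sup>2) \<partial>\<nu>) =
      (\<integral>\<^sup>+x. ennreal (h x) * ennreal ((sqrt (f x) - sqrt (g x))\<^sup>2) \<partial>R)"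
      unfolding eq by (subst nn_integral_density) auto
    also have "\<dots> = (\<integral>\<^sup>+x. ennreal ((sqrt (h x * f x) - sqrt (h x * g x))\<^sup>2) \<partial>R)"
    proof (rule nn_integral_cong)
      fix x assume x: "x \<in> space R"
      have "(sqrt (h x * f x) - sqrt (h x * g x))\<^sup>2 = (sqrt (h x))\<^sup>2 * (sqrt (f x) - sqrt (g x))\<^sup>2"
        by (simp add: real_sqrt_mult power_mult_distrib[symmetric] right_diff_distrib)
      also have "(sqrt (h x))\<^sup>2 = h x" using h0[OF x] by simp
      finally show "ennreal (h x) * ennreal ((sqrt (f x) - sqrt (g x))\<^sup>2) =
          ennreal ((sqrt (h x * f x) - sqrt (h x * g x))\<^sup>2)"
        using h0[OF x] by (simp add: ennreal_mult)
    qed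
    finally have I: "(\<integral>\<^sup>+x. ennreal ((sqrt (f x) - sqrt (g x))\<^sup>2) \<partial>\<nu>) =
      (\<integral>\<^sup>+x. ennreal ((sqrt (h x * f x) - sqrt (h x * g x))\<^sup>2) \<partial>R)" .
    have "\<Lambda> = density R (\<lambda>x. ennreal (h x * f x))" "\<mu> = density R (\<lambda>x. ennreal (h x * g x))"
      using d[of f] d[of g] f0 g0 is_densityD_eq[OF \<nu>(2)] is_densityD_eq[OF \<nu>(3)]
      by simp_all
    with I h0 show ?thesis by (intro exI[of _ h] conjI ballI) simp_all
  qed
  have R1: "sets \<nu>1 = sets R" and R2: "sets \<nu>2 = sets R" using R(2) s by simp_all
  note m = is_densityD_measurable[OF assms(2) R1] is_densityD_measurable[OF assms(3) R1]
    is_densityD_measurable[OF assms(5) R2] is_densityD_measurable[OF assms(6) R2]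
  note nn = is_densityD_nonneg[OF assms(2) R1] is_densityD_nonneg[OF assms(3) R1]
    is_densityD_nonneg[OF assms(5) R2] is_densityD_nonneg[OF assms(6) R2]
  obtain h1 where h1: "h1 \<in> borel_measurable R" "\<forall>x\<in>space R. 0 \<le> h1 x"
    "\<Lambda> = density R (\<lambda>x. ennreal (h1 x * f1 x))" "\<mu> = density R (\<lambda>x. ennreal (h1 x * g1 x))"
    "(\<integral>\<^sup>+x. ennreal ((sqrt (f1 x) - sqrt (g1 x))\<^sup>2) \<partial>\<nu>1) =
      (\<integral>\<^sup>+x. ennreal ((sqrt (h1 x * f1 x) - sqrt (h1 x * g1 x))\<^sup>2) \<partial>R)"
    using chg[OF assms(1,2,3) R1 R(3)] by blast
  obtain h2 where h2: "h2 \<in> borel_measurable R" "\<forall>x\<in>space R. 0 \<le> h2 x"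
    "\<Lambda> = density R (\<lambda>x. ennreal (h2 x * f2 x))" "\<mu> = density R (\<lambda>x. ennreal (h2 x * g2 x))"
    "(\<integral>\<^sup>+x. ennreal ((sqrt (f2 x) - sqrt (g2 x))\<^sup>2) \<partial>\<nu>2) =
      (\<integral>\<^sup>+x. ennreal ((sqrt (h2 x * f2 x) - sqrt (h2 x * g2 x))\<^sup>2) \<partial>R)"
    using chg[OF assms(4,5,6) R2 R(4)] by blast
  have "AE x in R. ennreal (h1 x * f1 x) = ennreal (h2 x * f2 x)"
    by (rule R.density_unique) (use m h1(1) h2(1) in measurable, simp flip: h1(3) h2(3))
  moreover have "AE x in R. ennreal (h1 x * g1 x) = ennreal (h2 x * g2 x)"
    by (rule R.density_unique) (use m h1(1) h2(1) in measurable, simp flip: h1(4) h2(4))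
  ultimately have "AE x in R. ennreal ((sqrt (h1 x * f1 x) - sqrt (h1 x * g1 x))\<^sup>2) =
      ennreal ((sqrt (h2 x * f2 x) - sqrt (h2 x * g2 x))\<^sup>2)"
    using AE_space by eventually_elim (use h1(2) h2(2) nn in simp)
  then have "(\<integral>\<^sup>+x. ennreal ((sqrt (h1 x * f1 x) - sqrt (h1 x * g1 x))\<^sup>2) \<partial>R) =
      (\<integral>\<^sup>+x. ennreal ((sqrt (h2 x * f2 x) - sqrt (h2 x * g2 x))\<^sup>2) \<partial>R)"
    by (rule nn_integral_cong_AE)
  then show ?thesis by (simp add: hellinger_via_def h1(5) h2(5))
qed

lemma hellinger_eq:
  assumes "sigma_finite_measure \<nu>" "is_density \<nu> \<Lambda> f" "is_density \<nu> \<mu> g"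
  shows "hellinger \<Lambda> \<mu> = hellinger_via \<nu> f g"
  unfolding hellinger_def
  using assms hellinger_via_unique by (intro the_equality) blast+

end

theory Submission
  imports Defs
begin

text \<open>
  For finitely many disjoint sets \<open>B i\<close> of finite intensity, the laws of the vector of counts under
  the two processes are product Poisson laws with affinity
  \<open>exp (- (\<Sum>i. (sqrt (\<Lambda> (B i)) - sqrt (\<mu> (B i)))\<^sup>2) / 2)\<close>. If the Hellinger distance is infinite,
  these affinities can be made arbitrarily small by cutting along dyadic levels of
  \<open>\<bar>sqrt (d\<Lambda>/d\<mu>) - 1\<bar>\<close>, and Borel--Cantelli yields a separating event.

  If it is finite, put \<open>h = d\<Lambda>/d\<mu>\<close> and \<open>E = {h > K}\<close>. Then \<open>\<Lambda> E\<close> is small, so that outside a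
  \<open>P\<^sub>\<Lambda>\<close>-small event there are no points in \<open>E\<close>; on the event of no points in \<open>E\<close> the likelihood ratio
  \<open>L\<close> of any finite vector of counts has second moment under \<open>P\<^sub>\<mu>\<close> bounded by a constant \<open>M\<close> that does
  not depend on the chosen sets, since \<open>(h - 1)\<^sup>2 \<le> (sqrt K + 1)\<^sup>2 (sqrt h - 1)\<^sup>2\<close> off \<open>E\<close>. With \<open>L \<le> t + L\<^sup>2 / t\<close> this gives
  \<open>P\<^sub>\<Lambda> A \<le> \<Lambda> E + M / t + t P\<^sub>\<mu> A\<close> for all cylinder events \<open>A\<close>, and by approximation for all events.
\<close>

section \<open>Poisson laws and vectors of counts\<close>

text \<open>Rate 0 fits the same series: since \<open>0 ^ 0 = 1\<close>, only the term at 0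
  survives, with weight 1. Later computations can therefore start from one formula for every finite
  rate.\<close>

lemma nn_integral_poisson_law:
  assumes r: "0 \<le> r" and [measurable]: "\<phi> \<in> borel_measurable borel"
  shows "(\<integral>\<^sup>+x. \<phi> x \<partial>poisson_law (ennreal r)) =
    (\<Sum>n. ennreal (exp (- r) * r ^ n / fact n) * \<phi> (of_nat n))"
proof (cases "r = 0")
  case True
  have "(\<Sum>n. ennreal (exp (- r) * r ^ n / fact n) * \<phi> (of_nat n)) =
      (\<Sum>n\<in>{0}. ennreal (exp (- r) * r ^ n / fact n) * \<phi> (of_nat n))"
    by (rule suminf_finite) (auto simp: True)
  then show ?thesis
    by (simp add: True poisson_law_def nn_integral_return)
next
  case False
  with r have r: "0 < r" by simp
  have "(\<integral>\<^sup>+x. \<phi> x \<partial>poisson_law (ennreal r)) =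
      (\<integral>\<^sup>+n. \<phi> (of_nat n) \<partial>measure_pmf (poisson_pmf r))"
    using r by (simp add: poisson_law_def nn_integral_distr ennreal_eq_0_iff)
  also have "\<dots> = (\<integral>\<^sup>+n. ennreal (exp (- r) * r ^ n / fact n) * \<phi> (of_nat n) \<partial>count_space UNIV)"
    unfolding nn_integral_measure_pmf using r
    by (intro nn_integral_cong) (simp add: mult_ac)
  finally show ?thesis by (simp add: nn_integral_count_space_nat)
qed

text \<open>Evaluations of a point pattern are extended reals, whereas likelihood ratios raise a
  real number to the number of points. The value \<open>\<infinity>\<close> is sent to 0; Poisson
  laws of finite rate charge the naturals only.\<close>

definition count_of :: "ennreal \<Rightarrow> nat" where
  "count_of x = nat \<lfloor>enn2real x\<rfloor>"

lemma count_of_of_nat [simp]: "count_of (of_nat n) = n"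
  by (simp add: count_of_def)

lemma count_of_measurable [measurable]: "count_of \<in> borel \<rightarrow>\<^sub>M count_space UNIV"
  unfolding count_of_def by measurable

text \<open>This is the probability generating function, obtained from the exponential series. The
  affinity is its value at \<open>sqrt (m / l)\<close>, and the second moment of the likelihood
  ratio comes from its value at \<open>(l / m)\<^sup>2\<close>.\<close>

lemma nn_integral_poisson_law_power:
  assumes r: "0 \<le> r" and c: "0 \<le> c"
  shows "(\<integral>\<^sup>+x. ennreal (c ^ count_of x) \<partial>poisson_law (ennreal r)) = ennreal (exp (r * (c - 1)))"
proof -
  have s: "(\<lambda>n. exp (- r) * ((r * c) ^ n / fact n)) sums (exp (- r) * exp (r * c))"
    using exp_converges[of "r * c"] by (intro sums_mult) (simp add: divide_inverse mult.commute)
  have "(\<integral>\<^sup>+x. ennreal (c ^ count_of x) \<partial>poisson_law (ennreal r)) =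
      (\<Sum>n. ennreal (exp (- r) * r ^ n / fact n) * ennreal (c ^ n))"
    by (subst nn_integral_poisson_law[OF r]) simp_all
  also have "\<dots> = (\<Sum>n. ennreal (exp (- r) * ((r * c) ^ n / fact n)))"
    using r c by (intro suminf_cong) (simp add: ennreal_mult[symmetric] power_mult_distrib mult_ac)
  also have "\<dots> = ennreal (exp (- r) * exp (r * c))"
    using s r c by (intro suminf_ennreal_eq) auto
  finally show ?thesis by (simp add: mult_exp_exp algebra_simps)
qed

text \<open>
  The likelihood ratio of Poisson laws of rates \<open>l\<close> and \<open>m\<close>. For \<open>l = m = 0\<close> it equals \<open>1\<close> at \<open>0\<close>,
  because \<open>0 / 0 = 0\<close> and \<open>0 ^ 0 = 1\<close>.
\<close>

definition poisson_lr :: "real \<Rightarrow> real \<Rightarrow> ennreal \<Rightarrow> ennreal" where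
  "poisson_lr l m x = ennreal (exp (m - l) * (l / m) ^ count_of x)"

lemma poisson_lr_measurable [measurable]: "poisson_lr l m \<in> borel_measurable borel"
  unfolding poisson_lr_def by measurable

text \<open>The identity holds weight by weight on the naturals. The hypothesis \<open>ac\<close>
  excludes \<open>m = 0 < l\<close>, where the law of rate \<open>m\<close> is concentrated at 0 and
  cannot carry a density for the law of rate \<open>l\<close>.\<close>

lemma nn_integral_poisson_lr:
  assumes l: "0 \<le> l" and m: "0 \<le> m" and ac: "m = 0 \<Longrightarrow> l = 0"
    and [measurable]: "\<phi> \<in> borel_measurable borel"
  shows "(\<integral>\<^sup>+x. \<phi> x * poisson_lr l m x \<partial>poisson_law (ennreal m)) = (\<integral>\<^sup>+x. \<phi> x \<partial>poisson_law (ennreal l))"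
proof -
  have *: "exp (- m) * m ^ n / fact n * (exp (m - l) * (l / m) ^ n) = exp (- l) * l ^ n / fact n" for n
  proof (cases "m = 0")
    case True
    with ac show ?thesis by (cases n) auto
  next
    case False
    then have "m ^ n * (l / m) ^ n = l ^ n" by (simp add: power_mult_distrib[symmetric])
    moreover have "exp (- m) * exp (m - l) = exp (- l)" by (simp add: mult_exp_exp)
    moreover have "exp (- m) * m ^ n / fact n * (exp (m - l) * (l / m) ^ n) =
        exp (- m) * exp (m - l) * (m ^ n * (l / m) ^ n) / fact n"
      by (simp only: times_divide_eq_left times_divide_eq_right mult_ac)
    ultimately show ?thesis by simp
  qed
  have "(\<integral>\<^sup>+x. \<phi> x * poisson_lr l m x \<partial>poisson_law (ennreal m)) =
    (\<Sum>n. ennreal (exp (- m) * m ^ n / fact n) * (\<phi> (of_nat n) * ennreal (exp (m - l) * (l / m) ^ n)))"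
    by (subst nn_integral_poisson_law[OF m]) (simp_all add: poisson_lr_def)
  also have "\<dots> = (\<Sum>n. ennreal (exp (- m) * m ^ n / fact n * (exp (m - l) * (l / m) ^ n)) * \<phi> (of_nat n))"
    using l m by (intro suminf_cong, subst ennreal_mult) (simp_all add: mult_ac)
  also have "\<dots> = (\<integral>\<^sup>+x. \<phi> x \<partial>poisson_law (ennreal l))"
    unfolding * using l by (simp add: nn_integral_poisson_law)
  finally show ?thesis .
qed

section \<open>Joint laws of counts and change of measure\<close>

lemma poisson_pp_measurable_emeasure:
  assumes "poisson_pp S \<Lambda> P" "B \<in> sets S"
  shows "(\<lambda>\<eta>. emeasure \<eta> B) \<in> borel_measurable P"
proof -
  have "sets P = sets (pp_algebra S)" using assms(1) by (simp add: poisson_pp_def)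
  from measurable_cong_sets[OF this refl, of borel] show ?thesis
    using measurable_emeasure_pp_algebra[OF assms(2)] by blast
qed

lemma nn_integral_poisson_pp:
  assumes P: "poisson_pp S \<Lambda> P" and B: "B \<in> sets S" and [measurable]: "\<phi> \<in> borel_measurable borel"
  shows "(\<integral>\<^sup>+\<eta>. \<phi> (emeasure \<eta> B) \<partial>P) = (\<integral>\<^sup>+x. \<phi> x \<partial>poisson_law (emeasure \<Lambda> B))"
proof -
  have "poisson_law (emeasure \<Lambda> B) = distr P borel (\<lambda>\<eta>. emeasure \<eta> B)"
    using P B by (simp add: poisson_pp_def)
  then show ?thesis
    using poisson_pp_measurable_emeasure[OF P B] by (simp add: nn_integral_distr)
qed

text \<open>Independence in \<open>poisson_pp\<close> is phrased for families over
  \<open>{..<n}\<close> with \<open>n\<close> at least 1. Enumerating \<open>I\<close> carries it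
  over to any finite index set, in particular to sets of membership patterns as used for atoms
  below; for empty \<open>I\<close> both sides are 1.\<close>

lemma nn_integral_poisson_pp_prod:
  fixes B :: "'i \<Rightarrow> 'a set" and \<phi> :: "'i \<Rightarrow> ennreal \<Rightarrow> ennreal"
  assumes P: "poisson_pp S \<Lambda> P" and I: "finite I" "B ` I \<subseteq> sets S" "disjoint_family_on B I"
    and \<phi>: "\<And>i. i \<in> I \<Longrightarrow> \<phi> i \<in> borel_measurable borel"
  shows "(\<integral>\<^sup>+\<eta>. (\<Prod>i\<in>I. \<phi> i (emeasure \<eta> (B i))) \<partial>P) =
    (\<Prod>i\<in>I. \<integral>\<^sup>+x. \<phi> i x \<partial>poisson_law (emeasure \<Lambda> (B i)))"
proof -
  interpret prob_space P using P by (simp add: poisson_pp_def)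
  show ?thesis
  proof (cases "I = {}")
    case True
    then show ?thesis by (simp add: emeasure_space_1)
  next
    case False
    define n where "n = card I"
    have n: "1 \<le> n" using False I(1) by (simp add: n_def Suc_le_eq card_gt_0_iff)
    obtain f where f: "bij_betw f {..<n} I"
      using ex_bij_betw_nat_finite[OF I(1)] unfolding n_def atLeast0LessThan by blast
    then have fI: "f i \<in> I" if "i < n" for i using that by (auto simp: bij_betw_def)
    have "(\<lambda>i. B (f i)) ` {..<n} \<subseteq> sets S" using fI I(2) by auto
    moreover have "disjoint_family_on (\<lambda>i. B (f i)) {..<n}"
      using I(3) f unfolding disjoint_family_on_def bij_betw_def inj_on_def by blast
    ultimately have ind: "indep_vars (\<lambda>_. borel) (\<lambda>i \<eta>. emeasure \<eta> (B (f i))) {..<n}"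
      using P n unfolding poisson_pp_def by blast
    have "(\<integral>\<^sup>+\<eta>. (\<Prod>i\<in>I. \<phi> i (emeasure \<eta> (B i))) \<partial>P) =
        (\<integral>\<^sup>+\<eta>. (\<Prod>i<n. \<phi> (f i) (emeasure \<eta> (B (f i)))) \<partial>P)"
      by (intro nn_integral_cong prod.reindex_bij_betw[OF f, symmetric])
    also have "\<dots> = (\<Prod>i<n. \<integral>\<^sup>+\<eta>. \<phi> (f i) (emeasure \<eta> (B (f i))) \<partial>P)"
    proof (rule indep_vars_nn_integral)
      show "indep_vars (\<lambda>_. borel) (\<lambda>i \<eta>. \<phi> (f i) (emeasure \<eta> (B (f i)))) {..<n}"
        using \<phi> fI by (intro indep_vars_compose2[OF ind, where Y="\<lambda>i. \<phi> (f i)"]) simp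
    qed simp_all
    also have "\<dots> = (\<Prod>i<n. \<integral>\<^sup>+x. \<phi> (f i) x \<partial>poisson_law (emeasure \<Lambda> (B (f i))))"
      using \<phi> fI I(2) by (intro prod.cong refl nn_integral_poisson_pp[OF P]) auto
    also have "\<dots> = (\<Prod>i\<in>I. \<integral>\<^sup>+x. \<phi> i x \<partial>poisson_law (emeasure \<Lambda> (B i)))"
      by (rule prod.reindex_bij_betw[OF f])
    finally show ?thesis .
  qed
qed

lemma sets_poisson_law [measurable_cong, simp]: "sets (poisson_law m) = sets borel"
  by (simp add: poisson_law_def)

lemma prob_space_poisson_law: "prob_space (poisson_law m)"
  unfolding poisson_law_def
  by (auto intro!: prob_space_return measure_pmf.prob_space_distr)

text \<open>A product measure is determined by its values on rectangles. The measure
  \<open>M\<close> is left general so that the criterion applies both to a Poisson process and to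
  another one reweighted by a likelihood ratio.\<close>

lemma distr_eq_PiM_poisson_law:
  fixes Y :: "'i \<Rightarrow> 'b \<Rightarrow> ennreal"
  assumes I: "finite I" and Y: "\<And>i. i \<in> I \<Longrightarrow> Y i \<in> borel_measurable M"
    and eq: "\<And>A. (\<And>i. i \<in> I \<Longrightarrow> A i \<in> sets borel) \<Longrightarrow>
      (\<integral>\<^sup>+\<eta>. (\<Prod>i\<in>I. indicator (A i) (Y i \<eta>)) \<partial>M) = (\<Prod>i\<in>I. emeasure (poisson_law (r i)) (A i))"
  shows "distr M (\<Pi>\<^sub>M i\<in>I. borel) (\<lambda>\<eta>. \<lambda>i\<in>I. Y i \<eta>) = (\<Pi>\<^sub>M i\<in>I. poisson_law (r i))"
proof -
  interpret product_sigma_finite "\<lambda>i. poisson_law (r i)"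
    by (intro product_sigma_finite.intro prob_space_imp_sigma_finite prob_space_poisson_law)
  have sets: "sets (\<Pi>\<^sub>M i\<in>I. poisson_law (r i)) = sets (\<Pi>\<^sub>M i\<in>I. borel)"
    by (intro sets_PiM_cong) simp_all
  have m: "(\<lambda>\<eta>. \<lambda>i\<in>I. Y i \<eta>) \<in> M \<rightarrow>\<^sub>M (\<Pi>\<^sub>M i\<in>I. borel)"
    using Y by (intro measurable_restrict) auto
  show ?thesis
  proof (rule PiM_eqI[OF I])
    fix A assume "\<And>i. i \<in> I \<Longrightarrow> A i \<in> sets (poisson_law (r i))"
    then have A: "A i \<in> sets borel" if "i \<in> I" for i using that by simp
    have pe: "Pi\<^sub>E I A \<in> sets (\<Pi>\<^sub>M i\<in>I. borel)"
      using A I by (intro sets_PiM_I_finite) auto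
    have "emeasure (distr M (\<Pi>\<^sub>M i\<in>I. borel) (\<lambda>\<eta>. \<lambda>i\<in>I. Y i \<eta>)) (Pi\<^sub>E I A) =
        (\<integral>\<^sup>+x. indicator (Pi\<^sub>E I A) x \<partial>distr M (\<Pi>\<^sub>M i\<in>I. borel) (\<lambda>\<eta>. \<lambda>i\<in>I. Y i \<eta>))"
      using pe by simp
    also have "\<dots> = (\<integral>\<^sup>+\<eta>. indicator (Pi\<^sub>E I A) (\<lambda>i\<in>I. Y i \<eta>) \<partial>M)"
      using m pe by (intro nn_integral_distr) auto
    also have "\<dots> = (\<integral>\<^sup>+\<eta>. (\<Prod>i\<in>I. indicator (A i) (Y i \<eta>)) \<partial>M)"
    proof (rule nn_integral_cong)
      fix \<eta>
      show "indicator (Pi\<^sub>E I A) (\<lambda>i\<in>I. Y i \<eta>) = (\<Prod>i\<in>I. indicator (A i) (Y i \<eta>) :: ennreal)"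
      proof (cases "\<forall>i\<in>I. Y i \<eta> \<in> A i")
        case True
        then have "(\<Prod>i\<in>I. indicator (A i) (Y i \<eta>) :: ennreal) = 1" by (intro prod.neutral) auto
        with True show ?thesis by (auto simp: indicator_def)
      next
        case False
        then have "(\<Prod>i\<in>I. indicator (A i) (Y i \<eta>) :: ennreal) = 0" using I by (intro prod_zero) (auto simp: indicator_def)
        with False show ?thesis by (auto simp: indicator_def PiE_iff)
      qed
    qed
    also have "\<dots> = (\<Prod>i\<in>I. emeasure (poisson_law (r i)) (A i))" by (rule eq) (rule A)
    finally show "emeasure (distr M (\<Pi>\<^sub>M i\<in>I. borel) (\<lambda>\<eta>. \<lambda>i\<in>I. Y i \<eta>)) (Pi\<^sub>E I A) =
      (\<Prod>i\<in>I. emeasure (poisson_law (r i)) (A i))" .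
  qed (simp add: sets)
qed

text \<open>The count vector sends both \<open>P\<close> and \<open>density Q ?L\<close> to the
  product of the Poisson laws with the rates of \<Lambda>: by independence the weight acts on each
  coordinate separately, and there \<open>poisson_lr\<close> turns the rate of \<mu> into that of
  \<Lambda>.\<close>

lemma poisson_pp_change_of_measure:
  fixes B :: "'i \<Rightarrow> 'a set"
  assumes P: "poisson_pp S \<Lambda> P" and Q: "poisson_pp S \<mu> Q"
    and I: "finite I" "B ` I \<subseteq> sets S" "disjoint_family_on B I"
    and fin: "\<And>i. i \<in> I \<Longrightarrow> emeasure \<Lambda> (B i) \<noteq> \<infinity>" "\<And>i. i \<in> I \<Longrightarrow> emeasure \<mu> (B i) \<noteq> \<infinity>"
    and ac: "\<And>i. i \<in> I \<Longrightarrow> measure \<mu> (B i) = 0 \<Longrightarrow> measure \<Lambda> (B i) = 0"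
    and X: "X \<in> sets (\<Pi>\<^sub>M i\<in>I. borel)"
  shows "emeasure P {\<eta> \<in> space P. (\<lambda>i\<in>I. emeasure \<eta> (B i)) \<in> X} =
    (\<integral>\<^sup>+\<eta>. (\<Prod>i\<in>I. poisson_lr (measure \<Lambda> (B i)) (measure \<mu> (B i)) (emeasure \<eta> (B i))) *
       indicator X (\<lambda>i\<in>I. emeasure \<eta> (B i)) \<partial>Q)"
proof -
  let ?Y = "\<lambda>\<eta>. \<lambda>i\<in>I. emeasure \<eta> (B i)"
  let ?l = "\<lambda>i. poisson_lr (measure \<Lambda> (B i)) (measure \<mu> (B i))"
  let ?L = "\<lambda>\<eta>. \<Prod>i\<in>I. ?l i (emeasure \<eta> (B i))"
  let ?N = "\<Pi>\<^sub>M i\<in>I. poisson_law (emeasure \<Lambda> (B i))"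
  have YP [measurable]: "(\<lambda>\<eta>. emeasure \<eta> (B i)) \<in> borel_measurable P" if "i \<in> I" for i
    using poisson_pp_measurable_emeasure[OF P] I(2) that by auto
  have YQ [measurable]: "(\<lambda>\<eta>. emeasure \<eta> (B i)) \<in> borel_measurable Q" if "i \<in> I" for i
    using poisson_pp_measurable_emeasure[OF Q] I(2) that by auto
  have mYP: "?Y \<in> P \<rightarrow>\<^sub>M (\<Pi>\<^sub>M i\<in>I. borel)" and mYQ: "?Y \<in> Q \<rightarrow>\<^sub>M (\<Pi>\<^sub>M i\<in>I. borel)"
    using YP YQ by (auto intro!: measurable_restrict)
  have mL: "?L \<in> borel_measurable Q" 
    by (intro borel_measurable_prod_ennreal measurable_compose[OF YQ] poisson_lr_measurable)
  have "distr P (\<Pi>\<^sub>M i\<in>I. borel) ?Y = ?N"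
  proof (rule distr_eq_PiM_poisson_law[OF I(1) YP])
    fix A :: "'i \<Rightarrow> ennreal set" assume [measurable]: "\<And>i. i \<in> I \<Longrightarrow> A i \<in> sets borel"
    show "(\<integral>\<^sup>+\<eta>. (\<Prod>i\<in>I. indicator (A i) (emeasure \<eta> (B i))) \<partial>P) =
        (\<Prod>i\<in>I. emeasure (poisson_law (emeasure \<Lambda> (B i))) (A i))"
      by (subst nn_integral_poisson_pp_prod[OF P I]) auto
  qed
  moreover have "distr (density Q ?L) (\<Pi>\<^sub>M i\<in>I. borel) ?Y = ?N"
  proof (rule distr_eq_PiM_poisson_law[OF I(1)])
    fix i assume "i \<in> I"
    then show "(\<lambda>\<eta>. emeasure \<eta> (B i)) \<in> borel_measurable (density Q ?L)" by simp
  next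
    fix A :: "'i \<Rightarrow> ennreal set" assume A [measurable]: "\<And>i. i \<in> I \<Longrightarrow> A i \<in> sets borel"
    have "(\<integral>\<^sup>+\<eta>. (\<Prod>i\<in>I. indicator (A i) (emeasure \<eta> (B i))) \<partial>density Q ?L) =
        (\<integral>\<^sup>+\<eta>. ?L \<eta> * (\<Prod>i\<in>I. indicator (A i) (emeasure \<eta> (B i))) \<partial>Q)"
      using mL by (intro nn_integral_density borel_measurable_prod_ennreal) auto
    also have "\<dots> = (\<integral>\<^sup>+\<eta>. (\<Prod>i\<in>I. indicator (A i) (emeasure \<eta> (B i)) * ?l i (emeasure \<eta> (B i))) \<partial>Q)"
      by (simp add: prod.distrib mult.commute)
    also have "\<dots> = (\<Prod>i\<in>I. \<integral>\<^sup>+x. indicator (A i) x * ?l i x \<partial>poisson_law (emeasure \<mu> (B i)))"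
      by (rule nn_integral_poisson_pp_prod[OF Q I, where \<phi>="\<lambda>i x. indicator (A i) x * ?l i x"]) auto
    also have "\<dots> = (\<Prod>i\<in>I. emeasure (poisson_law (emeasure \<Lambda> (B i))) (A i))"
    proof (rule prod.cong[OF refl])
      fix i assume i: "i \<in> I"
      have e: "emeasure \<mu> (B i) = ennreal (measure \<mu> (B i))" "emeasure \<Lambda> (B i) = ennreal (measure \<Lambda> (B i))"
        using fin[OF i] by (simp_all add: emeasure_eq_ennreal_measure top.not_eq_extremum)
      have "(\<integral>\<^sup>+x. indicator (A i) x * ?l i x \<partial>poisson_law (emeasure \<mu> (B i))) =
          (\<integral>\<^sup>+x. indicator (A i) x \<partial>poisson_law (emeasure \<Lambda> (B i)))"
        unfolding e using A[OF i] ac[OF i] by (intro nn_integral_poisson_lr) auto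
      then show "(\<integral>\<^sup>+x. indicator (A i) x * ?l i x \<partial>poisson_law (emeasure \<mu> (B i))) =
          emeasure (poisson_law (emeasure \<Lambda> (B i))) (A i)"
        using A[OF i] by simp
    qed
    finally show "(\<integral>\<^sup>+\<eta>. (\<Prod>i\<in>I. indicator (A i) (emeasure \<eta> (B i))) \<partial>density Q ?L) =
        (\<Prod>i\<in>I. emeasure (poisson_law (emeasure \<Lambda> (B i))) (A i))" .
  qed
  ultimately have eq: "emeasure (distr P (\<Pi>\<^sub>M i\<in>I. borel) ?Y) X =
      emeasure (distr (density Q ?L) (\<Pi>\<^sub>M i\<in>I. borel) ?Y) X" by simp
  have "emeasure P {\<eta> \<in> space P. ?Y \<eta> \<in> X} = emeasure (distr P (\<Pi>\<^sub>M i\<in>I. borel) ?Y) X"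
    using mYP X by (subst emeasure_distr) (auto intro!: arg_cong2[where f=emeasure])
  also have "\<dots> = emeasure (density Q ?L) (?Y -` X \<inter> space Q)"
    unfolding eq using mYQ X by (subst emeasure_distr) (auto simp: space_density)
  also have "\<dots> = (\<integral>\<^sup>+\<eta>. ?L \<eta> * indicator (?Y -` X \<inter> space Q) \<eta> \<partial>Q)"
    using mL mYQ X by (intro emeasure_density) (auto intro: measurable_sets)
  also have "\<dots> = (\<integral>\<^sup>+\<eta>. ?L \<eta> * indicator X (?Y \<eta>) \<partial>Q)"
    by (intro nn_integral_cong) (auto simp: indicator_def)
  finally show ?thesis .
qed

section \<open>Affinity and separating events\<close>

text \<open>The square root of the likelihood ratio of rate \<open>m\<close> to rate \<open>l\<close>.\<close>

definition affinity_factor :: "real \<Rightarrow> real \<Rightarrow> ennreal \<Rightarrow> real" where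
  "affinity_factor l m x = exp ((l - m) / 2) * sqrt (m / l) ^ count_of x"

lemma affinity_factor_measurable [measurable]: "affinity_factor l m \<in> borel_measurable borel"
  unfolding affinity_factor_def by measurable

lemma affinity_factor_nonneg: "0 \<le> l \<Longrightarrow> 0 \<le> m \<Longrightarrow> 0 \<le> affinity_factor l m x"
  by (simp add: affinity_factor_def)

text \<open>Exchanging the two rates inverts the root of the likelihood ratio. Where this root is
  below 1, the one for the exchanged rates is thus above 1.\<close>

lemma affinity_factor_inverse:
  assumes "0 < l" "0 < m"
  shows "affinity_factor l m x * affinity_factor m l x = 1"
proof -
  have "sqrt (m / l) * sqrt (l / m) = 1"
    using assms by (simp add: real_sqrt_mult[symmetric])
  then have "sqrt (m / l) ^ k * sqrt (l / m) ^ k = 1" for k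
    by (simp add: power_mult_distrib[symmetric])
  moreover have "exp ((l - m) / 2) * exp ((m - l) / 2) = 1"
    by (simp add: mult_exp_exp add_divide_distrib[symmetric])
  ultimately show ?thesis
    unfolding affinity_factor_def
    by (metis (no_types, lifting) mult.assoc mult.left_commute mult.right_neutral)
qed

text \<open>The generating function at \<open>sqrt (m / l)\<close> contributes the exponent
  \<open>sqrt l * sqrt m - l\<close>; together with \<open>(l - m) / 2\<close> this completes the
  square.\<close>

lemma nn_integral_affinity_factor:
  assumes "0 < l" "0 < m"
  shows "(\<integral>\<^sup>+x. ennreal (affinity_factor l m x) \<partial>poisson_law (ennreal l)) =
    ennreal (exp (- ((sqrt l - sqrt m)\<^sup>2 / 2)))"
proof -
  have "(\<integral>\<^sup>+x. ennreal (affinity_factor l m x) \<partial>poisson_law (ennreal l)) =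
      ennreal (exp ((l - m) / 2)) * (\<integral>\<^sup>+x. ennreal (sqrt (m / l) ^ count_of x) \<partial>poisson_law (ennreal l))"
    using assms unfolding affinity_factor_def
    by (subst nn_integral_cmult[symmetric]) (simp_all add: ennreal_mult)
  also have "\<dots> = ennreal (exp ((l - m) / 2 + l * (sqrt (m / l) - 1)))"
    using assms by (subst nn_integral_poisson_law_power)
      (simp_all add: ennreal_mult[symmetric] mult_exp_exp)
  also have "l * sqrt (m / l) = sqrt l * sqrt m"
    using assms by (simp add: real_sqrt_divide field_simps)
  then have "(l - m) / 2 + l * (sqrt (m / l) - 1) = - ((sqrt l - sqrt m)\<^sup>2 / 2)"
    using assms by (simp add: right_diff_distrib power2_diff field_simps)
  finally show ?thesis .
qed

lemma nn_integral_prod_affinity_factor: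
  fixes B :: "'i \<Rightarrow> 'a set"
  assumes P: "poisson_pp S \<Lambda> P"
    and I: "finite I" "B ` I \<subseteq> sets S" "disjoint_family_on B I"
    and fin: "\<And>i. i \<in> I \<Longrightarrow> emeasure \<Lambda> (B i) = ennreal (l i)"
    and pos: "\<And>i. i \<in> I \<Longrightarrow> 0 < l i" "\<And>i. i \<in> I \<Longrightarrow> 0 < m i"
  shows "(\<integral>\<^sup>+\<eta>. ennreal (\<Prod>i\<in>I. affinity_factor (l i) (m i) (emeasure \<eta> (B i))) \<partial>P) =
    ennreal (exp (- ((\<Sum>i\<in>I. (sqrt (l i) - sqrt (m i))\<^sup>2) / 2)))"
proof -
  have "(\<integral>\<^sup>+\<eta>. ennreal (\<Prod>i\<in>I. affinity_factor (l i) (m i) (emeasure \<eta> (B i))) \<partial>P) =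
      (\<integral>\<^sup>+\<eta>. (\<Prod>i\<in>I. ennreal (affinity_factor (l i) (m i) (emeasure \<eta> (B i)))) \<partial>P)"
    using pos by (intro nn_integral_cong prod_ennreal[symmetric] affinity_factor_nonneg) (auto intro: less_imp_le)
  also have "\<dots> = (\<Prod>i\<in>I. \<integral>\<^sup>+x. ennreal (affinity_factor (l i) (m i) x) \<partial>poisson_law (emeasure \<Lambda> (B i)))"
    by (rule nn_integral_poisson_pp_prod[OF P I, where \<phi>="\<lambda>i x. ennreal (affinity_factor (l i) (m i) x)"]) auto
  also have "\<dots> = (\<Prod>i\<in>I. ennreal (exp (- ((sqrt (l i) - sqrt (m i))\<^sup>2 / 2))))"
    using fin pos by (intro prod.cong refl) (simp add: nn_integral_affinity_factor)
  also have "\<dots> = ennreal (\<Prod>i\<in>I. exp (- ((sqrt (l i) - sqrt (m i))\<^sup>2 / 2)))"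
    by (intro prod_ennreal) simp
  also have "(\<Prod>i\<in>I. exp (- ((sqrt (l i) - sqrt (m i))\<^sup>2 / 2))) =
      exp (- ((\<Sum>i\<in>I. (sqrt (l i) - sqrt (m i))\<^sup>2) / 2))"
    using I(1) by (simp add: exp_sum[symmetric] sum_negf sum_divide_distrib)
  finally show ?thesis .
qed

lemma emeasure_le_nn_integral:
  assumes "A \<in> sets M" "\<And>x. x \<in> A \<Longrightarrow> 1 \<le> f x"
  shows "emeasure M A \<le> (\<integral>\<^sup>+x. f x \<partial>M)"
proof -
  have "emeasure M A = (\<integral>\<^sup>+x. indicator A x \<partial>M)" using assms(1) by simp
  also have "\<dots> \<le> (\<integral>\<^sup>+x. f x \<partial>M)"
    using assms(2) by (intro nn_integral_mono) (auto simp: indicator_def)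
  finally show ?thesis .
qed

text \<open>The event is that the root \<open>L\<close> of the likelihood ratio of \<open>Q\<close>
  to \<open>P\<close> is at least 1. Under \<open>P\<close>, Markov's inequality bounds it by the
  mean of \<open>L\<close>. Off the event the inverse of \<open>L\<close> is at least 1, and
  Markov's inequality under \<open>Q\<close> applies. Both means equal the affinity
  \<open>h\<close>.\<close>

lemma poisson_pp_separating_event:
  fixes B :: "'i \<Rightarrow> 'a set"
  assumes P: "poisson_pp S \<Lambda> P" and Q: "poisson_pp S \<mu> Q"
    and I: "finite I" "B ` I \<subseteq> sets S" "disjoint_family_on B I"
    and fin: "\<And>i. i \<in> I \<Longrightarrow> emeasure \<Lambda> (B i) = ennreal (l i)" "\<And>i. i \<in> I \<Longrightarrow> emeasure \<mu> (B i) = ennreal (m i)"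
    and pos: "\<And>i. i \<in> I \<Longrightarrow> 0 < l i" "\<And>i. i \<in> I \<Longrightarrow> 0 < m i"
  defines "h \<equiv> ennreal (exp (- ((\<Sum>i\<in>I. (sqrt (l i) - sqrt (m i))\<^sup>2) / 2)))"
  obtains A where "A \<in> sets P" "emeasure P A \<le> h" "emeasure Q (space Q - A) \<le> h"
proof -
  have PQ: "sets P = sets Q" using P Q by (simp add: poisson_pp_def)
  define L where "L l m \<eta> = (\<Prod>i\<in>I. affinity_factor (l i) (m i) (emeasure \<eta> (B i)))"
    for l m :: "'i \<Rightarrow> real" and \<eta> :: "'a measure"
  have L0: "0 \<le> L l m \<eta>" "0 \<le> L m l \<eta>" for \<eta>
    unfolding L_def using pos by (auto intro!: prod_nonneg affinity_factor_nonneg intro: less_imp_le)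
  have LL: "L l m \<eta> * L m l \<eta> = 1" for \<eta>
    unfolding L_def prod.distrib[symmetric] using pos by (intro prod.neutral) (simp add: affinity_factor_inverse)
  have [measurable]: "L l m \<in> borel_measurable P"
    unfolding L_def using I(2)
    by (intro borel_measurable_prod measurable_compose[OF poisson_pp_measurable_emeasure[OF P]]) auto
  define A where "A = {\<eta> \<in> space P. 1 \<le> L l m \<eta>}"
  have A: "A \<in> sets P" unfolding A_def by measurable
  have "emeasure P A \<le> (\<integral>\<^sup>+\<eta>. ennreal (L l m \<eta>) \<partial>P)"
    using A by (intro emeasure_le_nn_integral) (auto simp: A_def)
  also have "\<dots> = h"
    unfolding L_def h_def by (rule nn_integral_prod_affinity_factor[OF P I fin(1) pos])
  finally have 1: "emeasure P A \<le> h" .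
  have "1 \<le> L m l \<eta>" if "\<eta> \<in> space Q - A" for \<eta>
  proof (rule ccontr)
    assume "\<not> 1 \<le> L m l \<eta>"
    moreover have "L l m \<eta> < 1"
      using that sets_eq_imp_space_eq[OF PQ] by (auto simp: A_def)
    ultimately have "L l m \<eta> * L m l \<eta> < 1"
      using L0[of \<eta>] mult_strict_mono[of "L l m \<eta>" 1 "L m l \<eta>" 1] by auto
    then show False using LL[of \<eta>] by simp
  qed
  then have "emeasure Q (space Q - A) \<le> (\<integral>\<^sup>+\<eta>. ennreal (L m l \<eta>) \<partial>Q)"
    using A PQ by (intro emeasure_le_nn_integral) auto
  also have "\<dots> = ennreal (exp (- ((\<Sum>i\<in>I. (sqrt (m i) - sqrt (l i))\<^sup>2) / 2)))"
    unfolding L_def by (rule nn_integral_prod_affinity_factor[OF Q I fin(2) pos(2,1)])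
  also have "\<dots> = h" unfolding h_def by (simp add: power2_commute)
  finally show ?thesis using that[OF A 1] by blast
qed

section \<open>Extension from a generating algebra\<close>

text \<open>A single \<open>B\<close> has to serve both measures, so that an inequality between them
  can be transferred from \<open>B\<close> to \<open>A\<close>. The induction carries both estimates
  along: complements keep the symmetric difference, and countable unions are first cut down to
  finite ones.\<close>

lemma sigma_sets_approx:
  assumes alg: "algebra \<Omega> \<A>"
    and fin: "finite_measure P" "finite_measure Q"
    and sets: "sets P = sigma_sets \<Omega> \<A>" "sets Q = sigma_sets \<Omega> \<A>"
    and A: "A \<in> sigma_sets \<Omega> \<A>" and e: "0 < (e::real)"
  shows "\<exists>B\<in>\<A>. measure P (sym_diff A B) < e \<and> measure Q (sym_diff A B) < e"
proof -
  interpret algebra \<Omega> \<A> by fact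
  interpret P: finite_measure P by fact
  interpret Q: finite_measure Q by fact
  have inP: "B \<in> sets P" "B \<in> sets Q" if "B \<in> \<A>" for B
    using that by (auto simp: sets)
  define near where "near A B e \<longleftrightarrow> measure P (sym_diff A B) < e \<and> measure Q (sym_diff A B) < e"
    for A B and e :: real
  \<comment> \<open>Errors add up under both measures, so approximants can be combined.\<close>
  have near_mono: "near A B (d + e)"
    if "sym_diff A B \<subseteq> D \<union> E" "measure P D < d" "measure Q D < d" "measure P E < e" "measure Q E < e"
      "D \<in> sets P" "E \<in> sets P" for A B D E d e
  proof -
    have "measure P (sym_diff A B) \<le> measure P D + measure P E"
      using P.finite_measure_mono[OF that(1)] measure_Un_le[of D P E] that(6,7) by auto
    moreover have "measure Q (sym_diff A B) \<le> measure Q D + measure Q E"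
      using Q.finite_measure_mono[OF that(1)] measure_Un_le[of D Q E] that(6,7) sets sets.Un[of D Q E]
      by auto
    ultimately show ?thesis using that by (auto simp: near_def)
  qed
  have "\<forall>e>0. \<exists>B\<in>\<A>. near A B e"
    using A
  proof induction
    case (Basic a)
    then show ?case by (auto simp: near_def intro!: bexI[of _ a])
  next
    case Empty
    then show ?case by (auto simp: near_def intro!: bexI[of _ "{}"])
  next
    case (Compl a)
    show ?case
    proof (intro allI impI)
      fix e :: real assume "0 < e"
      then obtain B where B: "B \<in> \<A>" "near a B e" using Compl.IH by blast
      have "a \<subseteq> \<Omega>" using Compl.hyps sigma_sets_into_sp[OF space_closed] by auto
      then have "sym_diff (\<Omega> - a) (\<Omega> - B) = sym_diff a B"
        using sets_into_space[OF B(1)] by blast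
      then show "\<exists>B\<in>\<A>. near (\<Omega> - a) B e"
        using B by (intro bexI[of _ "\<Omega> - B"]) (auto simp: near_def)
    qed
  next
    case (Union a)
    have a: "a i \<in> sets P" "a i \<in> sets Q" for i using Union.hyps by (simp_all add: sets)
    have fin_un: "\<forall>e>0. \<exists>B\<in>\<A>. near (\<Union>i<n. a i) B e" for n
    proof (induction n)
      case 0
      then show ?case by (auto simp: near_def intro!: bexI[of _ "{}"])
    next
      case (Suc n)
      show ?case
      proof (intro allI impI)
        fix e :: real assume e: "0 < e"
        obtain B where B: "B \<in> \<A>" "near (\<Union>i<n. a i) B (e/2)" using Suc e half_gt_zero by blast
        obtain C where C: "C \<in> \<A>" "near (a n) C (e/2)" using Union.IH e half_gt_zero by blast
        have "near (\<Union>i<Suc n. a i) (B \<union> C) (e/2 + e/2)"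
        proof (rule near_mono)
          show "sym_diff (\<Union>i<Suc n. a i) (B \<union> C) \<subseteq> sym_diff (\<Union>i<n. a i) B \<union> sym_diff (a n) C"
            by (auto simp: less_Suc_eq)
        qed (use B C a inP in \<open>auto simp: near_def\<close>)
        then show "\<exists>B\<in>\<A>. near (\<Union>i<Suc n. a i) B e" using B C by auto
      qed
    qed
    show ?case
    proof (intro allI impI)
      fix e :: real assume e: "0 < e"
      \<comment> \<open>The remainders decrease to the empty set, so by continuity from above a
        common \<open>n\<close> makes them small under \<open>P\<close> and under
        \<open>Q\<close>.\<close>
      define U where "U n = (\<Union>i. a i) - (\<Union>i<n. a i)" for n
      have U: "U n \<in> sets P" "U n \<in> sets Q" for n using a by (auto simp: U_def)
      have dec: "decseq U" by (force simp: U_def decseq_def)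
      have int: "(\<Inter>n. U n) = {}" by (auto simp: U_def)
      have "(\<lambda>n. measure P (U n)) \<longlonglongrightarrow> 0"
        using P.finite_Lim_measure_decseq[OF _ dec] U int by auto
      moreover have "(\<lambda>n. measure Q (U n)) \<longlonglongrightarrow> 0"
        using Q.finite_Lim_measure_decseq[OF _ dec] U int by auto
      ultimately have "\<forall>\<^sub>F n in sequentially. measure P (U n) < e/2 \<and> measure Q (U n) < e/2"
        using e by (intro eventually_conj order_tendstoD(2)) auto
      then obtain n where n: "measure P (U n) < e/2" "measure Q (U n) < e/2"
        by (auto simp: eventually_sequentially)
      obtain B where B: "B \<in> \<A>" "near (\<Union>i<n. a i) B (e/2)" using fin_un e half_gt_zero by blast
      have "near (\<Union>i. a i) B (e/2 + e/2)"
      proof (rule near_mono)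
        show "sym_diff (\<Union>i. a i) B \<subseteq> U n \<union> sym_diff (\<Union>i<n. a i) B"
          by (auto simp: U_def)
      qed (use B U n a inP in \<open>auto simp: near_def\<close>)
      then show "\<exists>B\<in>\<A>. near (\<Union>i. a i) B e" using B by auto
    qed
  qed
  then show ?thesis using e by (simp add: near_def)
qed

lemma measure_le_of_generating_algebra:
  assumes alg: "algebra \<Omega> \<A>"
    and fin: "finite_measure P" "finite_measure Q"
    and sets: "sets P = sigma_sets \<Omega> \<A>" "sets Q = sigma_sets \<Omega> \<A>"
    and t: "0 \<le> (t::real)" and bound: "\<And>B. B \<in> \<A> \<Longrightarrow> measure P B \<le> a + t * measure Q B"
    and A: "A \<in> sets P"
  shows "measure P A \<le> a + t * measure Q A"
proof (rule field_le_epsilon)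
  interpret P: finite_measure P by fact
  interpret Q: finite_measure Q by fact
  fix e :: real assume e: "0 < e"
  \<comment> \<open>Replacing \<open>A\<close> by its approximant costs \<open>d\<close> under
    \<open>P\<close> and \<open>t * d\<close> under \<open>Q\<close>, which must add up to
    \<open>e\<close>.\<close>
  define d where "d = e / (1 + t)"
  have "(1 + t) * d = e" using t by (simp add: d_def)
  then have d: "0 < d" "d + t * d = e" using e t by (simp_all add: distrib_right) (simp add: d_def)
  obtain B where B: "B \<in> \<A>" "measure P (sym_diff A B) < d" "measure Q (sym_diff A B) < d"
    using sigma_sets_approx[OF alg fin sets _ d(1), of A] A sets by auto
  have ms: "A \<in> sets P" "B \<in> sets P" "A \<in> sets Q" "B \<in> sets Q"
    using A B(1) sets by auto
  have "measure P A \<le> measure P (B \<union> sym_diff A B)"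
    using ms by (intro P.finite_measure_mono) auto
  also have "\<dots> \<le> measure P B + measure P (sym_diff A B)"
    using ms by (intro measure_Un_le) auto
  finally have 1: "measure P A \<le> measure P B + d" using B by simp
  have "measure Q B \<le> measure Q (A \<union> sym_diff A B)"
    using ms by (intro Q.finite_measure_mono) auto
  also have "\<dots> \<le> measure Q A + measure Q (sym_diff A B)"
    using ms by (intro measure_Un_le) auto
  finally have "t * measure Q B \<le> t * (measure Q A + d)" using B t by (intro mult_left_mono) auto
  with 1 bound[OF B(1)] d(2) show "measure P A \<le> a + t * measure Q A + e"
    by (simp add: distrib_left)
qed

text \<open>On a \<open>Q\<close>-null set the term with \<open>t\<close> vanishes, so
  \<open>t\<close> may grow without bound as \<open>e\<close> tends to 0. A mere implication between
  null sets would not pass from the algebra to the sigma-algebra, but this linear inequality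
  does.\<close>

lemma absolutely_continuous_of_generating_algebra:
  assumes alg: "algebra \<Omega> \<A>"
    and fin: "finite_measure P" "finite_measure Q"
    and sets: "sets P = sigma_sets \<Omega> \<A>" "sets Q = sigma_sets \<Omega> \<A>"
    and bound: "\<And>e::real. 0 < e \<Longrightarrow> \<exists>t\<ge>0. \<forall>B\<in>\<A>. measure P B \<le> e + t * measure Q B"
  shows "absolutely_continuous Q P"
  unfolding absolutely_continuous_def
proof
  interpret P: finite_measure P by fact
  fix A assume A: "A \<in> null_sets Q"
  then have AP: "A \<in> sets P" using sets by auto
  have Q0: "measure Q A = 0" using A by (simp add: null_sets_def measure_def)
  have "measure P A \<le> 0 + e" if e: "0 < e" for e
  proof -
    obtain t where t: "0 \<le> t" "\<And>B. B \<in> \<A> \<Longrightarrow> measure P B \<le> e + t * measure Q B"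
      using bound[OF e] by blast
    show ?thesis
      using measure_le_of_generating_algebra[OF alg fin sets t AP] Q0 by simp
  qed
  then have "measure P A \<le> 0" by (rule field_le_epsilon)
  then have "measure P A = 0" by (simp add: measure_le_0_iff)
  then show "A \<in> null_sets P"
    using AP by (simp add: P.emeasure_eq_measure null_sets_def)
qed

section \<open>Cylinder events and the sigma-algebra of point patterns\<close>

definition cylinders :: "'a measure \<Rightarrow> 'a set set \<Rightarrow> 'a measure set set" where
  "cylinders S F = {{\<eta> \<in> point_patterns S. (\<lambda>B\<in>J. emeasure \<eta> B) \<in> X} | J X.
     finite J \<and> J \<subseteq> F \<and> X \<in> sets (\<Pi>\<^sub>M B\<in>J. (borel :: ennreal measure))}"

lemma algebra_cylinders: "algebra (point_patterns S) (cylinders S F)"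
  unfolding algebra_iff_Un
proof (intro conjI ballI)
  show "cylinders S F \<subseteq> Pow (point_patterns S)" by (auto simp: cylinders_def)
  show "{} \<in> cylinders S F"
    unfolding cylinders_def by (intro CollectI exI[of _ "{}"]) auto
next
  fix a assume "a \<in> cylinders S F"
  then obtain J X where J: "finite J" "J \<subseteq> F" "X \<in> sets (\<Pi>\<^sub>M B\<in>J. (borel :: ennreal measure))"
    and a: "a = {\<eta> \<in> point_patterns S. (\<lambda>B\<in>J. emeasure \<eta> B) \<in> X}"
    unfolding cylinders_def by blast
  have "point_patterns S - a = {\<eta> \<in> point_patterns S. (\<lambda>B\<in>J. emeasure \<eta> B) \<in>
      space (\<Pi>\<^sub>M B\<in>J. (borel :: ennreal measure)) - X}"
    by (auto simp: a space_PiM)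
  then show "point_patterns S - a \<in> cylinders S F"
    unfolding cylinders_def using J by blast
next
  fix a b assume "a \<in> cylinders S F" "b \<in> cylinders S F"
  then obtain J X K Y where J: "finite J" "J \<subseteq> F" "X \<in> sets (\<Pi>\<^sub>M B\<in>J. (borel :: ennreal measure))"
    and a: "a = {\<eta> \<in> point_patterns S. (\<lambda>B\<in>J. emeasure \<eta> B) \<in> X}"
    and K: "finite K" "K \<subseteq> F" "Y \<in> sets (\<Pi>\<^sub>M B\<in>K. (borel :: ennreal measure))"
    and b: "b = {\<eta> \<in> point_patterns S. (\<lambda>B\<in>K. emeasure \<eta> B) \<in> Y}"
    unfolding cylinders_def by blast
  let ?M = "\<Pi>\<^sub>M B\<in>J \<union> K. (borel :: ennreal measure)"
  \<comment> \<open>Both base sets are pulled back to the joint coordinates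
    \<open>J \<union> K\<close> along the restriction maps.\<close>
  define Z where "Z = ((\<lambda>x. restrict x J) -` X \<inter> space ?M) \<union> ((\<lambda>x. restrict x K) -` Y \<inter> space ?M)"
  have "Z \<in> sets ?M"
    unfolding Z_def using J(3) K(3)
    by (intro sets.Un measurable_sets[OF measurable_restrict_subset]) auto
  moreover have "a \<union> b = {\<eta> \<in> point_patterns S. (\<lambda>B\<in>J \<union> K. emeasure \<eta> B) \<in> Z}"
    by (auto simp: a b Z_def space_PiM Int_absorb1 Int_absorb2 Un_Int_distrib)
  ultimately show "a \<union> b \<in> cylinders S F"
    unfolding cylinders_def using J K by (intro CollectI exI[of _ "J \<union> K"] exI[of _ Z]) auto
qed

text \<open>The evaluation at any \<open>B\<close> is the series of the evaluations at the pieces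
  \<open>B \<inter> D i\<close>, which lie in \<open>F\<close>. Evaluations at sets of finite
  intensity therefore suffice, although the intensities are only sigma-finite.\<close>

lemma sets_pp_algebra_cylinders:
  fixes D :: "nat \<Rightarrow> 'a set"
  assumes F: "F \<subseteq> sets S" and D: "disjoint_family D" "(\<Union>i. D i) = space S" "range D \<subseteq> sets S"
    and FD: "\<And>B i. B \<in> sets S \<Longrightarrow> B \<inter> D i \<in> F"
  shows "sets (pp_algebra S) = sigma_sets (point_patterns S) (cylinders S F)"
proof
  have cyl: "cylinders S F \<subseteq> Pow (point_patterns S)" by (auto simp: cylinders_def)
  let ?C = "sigma (point_patterns S) (cylinders S F)"
  show "sets (pp_algebra S) \<subseteq> sigma_sets (point_patterns S) (cylinders S F)"
  proof -
    have ev: "(\<lambda>\<eta>. emeasure \<eta> B) \<in> borel_measurable ?C" if B: "B \<in> F" for B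
    proof (rule measurableI)
      fix A :: "ennreal set" assume A: "A \<in> sets borel"
      have "(\<lambda>x. x B) -` A \<inter> space (\<Pi>\<^sub>M B\<in>{B}. (borel :: ennreal measure)) \<in> sets (\<Pi>\<^sub>M B\<in>{B}. borel)"
        using A by (intro measurable_sets[OF measurable_component_singleton]) auto
      moreover have "(\<lambda>\<eta>. emeasure \<eta> B) -` A \<inter> space ?C = {\<eta> \<in> point_patterns S. (\<lambda>B\<in>{B}. emeasure \<eta> B) \<in>
          (\<lambda>x. x B) -` A \<inter> space (\<Pi>\<^sub>M B\<in>{B}. (borel :: ennreal measure))}"
        by (auto simp: space_PiM space_measure_of_conv)
      ultimately have "(\<lambda>\<eta>. emeasure \<eta> B) -` A \<inter> space ?C \<in> cylinders S F"
        unfolding cylinders_def using B by blast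
      then show "(\<lambda>\<eta>. emeasure \<eta> B) -` A \<inter> space ?C \<in> sets ?C" using cyl by auto
    qed simp
    have ev': "(\<lambda>\<eta>. emeasure \<eta> B) \<in> borel_measurable ?C" if B: "B \<in> sets S" for B
    proof -
      have "emeasure \<eta> B = (\<Sum>i. emeasure \<eta> (B \<inter> D i))" if "\<eta> \<in> space ?C" for \<eta>
      proof -
        have s: "sets \<eta> = sets S" using that by (auto simp: space_measure_of_conv point_patterns_def)
        have "(\<Sum>i. emeasure \<eta> (B \<inter> D i)) = emeasure \<eta> (\<Union>i. B \<inter> D i)"
          using D(1,3) B s by (intro suminf_emeasure) (auto simp: disjoint_family_on_def)
        also have "(\<Union>i. B \<inter> D i) = B" using D(2) sets.sets_into_space[OF B] by auto
        finally show ?thesis by simp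
      qed
      then show ?thesis
        using ev FD[OF B] by (subst measurable_cong) (auto intro!: borel_measurable_suminf_order)
    qed
    \<comment> \<open>The inclusion of sigma-algebras is obtained as measurability of the identity
      map.\<close>
    have "(\<lambda>\<eta>. \<eta>) \<in> ?C \<rightarrow>\<^sub>M pp_algebra S"
      unfolding pp_algebra_def
    proof (rule measurable_SUP2)
      show "sets S \<noteq> {}" by auto
      fix B assume B: "B \<in> sets S"
      show "(\<lambda>\<eta>. \<eta>) \<in> ?C \<rightarrow>\<^sub>M vimage_algebra (point_patterns S) (\<lambda>\<eta>. emeasure \<eta> B) borel"
        by (rule measurable_vimage_algebra2) (auto simp: space_measure_of_conv intro: ev'[OF B])
    qed auto
    then have "(\<lambda>\<eta>. \<eta>) -` A \<inter> space ?C \<in> sets ?C" if "A \<in> sets (pp_algebra S)" for A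
      using that by (rule measurable_sets)
    moreover have "(\<lambda>\<eta>. \<eta>) -` A \<inter> space ?C = A" if "A \<in> sets (pp_algebra S)" for A
      using sets.sets_into_space[OF that] by (auto simp: space_pp_algebra space_measure_of_conv)
    ultimately show ?thesis using cyl by auto
  qed
  have "cylinders S F \<subseteq> sets (pp_algebra S)"
  proof
    fix a assume "a \<in> cylinders S F"
    then obtain J X where J: "finite J" "J \<subseteq> F" "X \<in> sets (\<Pi>\<^sub>M B\<in>J. (borel :: ennreal measure))"
      and a: "a = {\<eta> \<in> point_patterns S. (\<lambda>B\<in>J. emeasure \<eta> B) \<in> X}"
      unfolding cylinders_def by blast
    have "(\<lambda>\<eta>. \<lambda>B\<in>J. emeasure \<eta> B) \<in> pp_algebra S \<rightarrow>\<^sub>M (\<Pi>\<^sub>M B\<in>J. borel)"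
      using J(2) F by (intro measurable_restrict measurable_emeasure_pp_algebra) auto
    from measurable_sets[OF this J(3)] show "a \<in> sets (pp_algebra S)"
      by (simp add: a space_pp_algebra vimage_def Int_def conj_commute)
  qed
  then show "sigma_sets (point_patterns S) (cylinders S F) \<subseteq> sets (pp_algebra S)"
    unfolding space_pp_algebra[symmetric] by (rule sets.sigma_sets_subset)
qed

section \<open>Bounded likelihood ratios on cylinder events\<close>

text \<open>For \<open>k \<subseteq> J\<close> these are the cells of the finite algebra generated
  by \<open>J\<close>, indexed by membership pattern. The empty pattern gives the part of the space
  outside all members of \<open>J\<close>; it is left out later, as its intensity may be
  infinite.\<close>

definition atom :: "'a measure \<Rightarrow> 'a set set \<Rightarrow> 'a set set \<Rightarrow> 'a set" where
  "atom S J k = {x \<in> space S. \<forall>b\<in>J. x \<in> b \<longleftrightarrow> b \<in> k}"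

lemma atom_sets:
  assumes "finite J" "J \<subseteq> sets S"
  shows "atom S J k \<in> sets S"
  unfolding atom_def
proof (rule sets.sets_Collect_finite_All[OF _ assms(1)])
  fix b assume "b \<in> J"
  then have [measurable]: "b \<in> sets S" using assms(2) by auto
  show "{x \<in> space S. x \<in> b \<longleftrightarrow> b \<in> k} \<in> sets S" by measurable
qed

lemma disjoint_atoms: "disjoint_family_on (atom S J) (Pow J)"
  unfolding disjoint_family_on_def
proof (intro ballI impI)
  fix k l assume "k \<in> Pow J" "l \<in> Pow J" "k \<noteq> l"
  then obtain b where "b \<in> J" "b \<in> k \<longleftrightarrow> b \<notin> l" by blast
  then show "atom S J k \<inter> atom S J l = {}" by (auto simp: atom_def)
qed

lemma atom_subset: "b \<in> J \<Longrightarrow> b \<in> k \<Longrightarrow> atom S J k \<subseteq> b"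
  by (auto simp: atom_def)

lemma emeasure_sum_atoms:
  assumes J: "finite J" "J \<subseteq> sets S" and b: "b \<in> J" and M: "sets M = sets S"
  shows "emeasure M b = (\<Sum>k | k \<in> Pow J - {{}} \<and> b \<in> k. emeasure M (atom S J k))"
proof -
  let ?I = "{k. k \<in> Pow J - {{}} \<and> b \<in> k}"
  have "b \<subseteq> space S" using b J(2) sets.sets_into_space by blast
  then have "b \<subseteq> (\<Union>k\<in>?I. atom S J k)"
    using b by (auto simp: atom_def intro!: exI[of _ "{c \<in> J. _ \<in> c}"])
  moreover have "(\<Union>k\<in>?I. atom S J k) \<subseteq> b"
    using b by (auto dest: atom_subset[THEN subsetD])
  ultimately have "b = (\<Union>k\<in>?I. atom S J k)" by blast
  moreover have "(\<Sum>k\<in>?I. emeasure M (atom S J k)) = emeasure M (\<Union>k\<in>?I. atom S J k)"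
    using J M atom_sets[OF J]
    by (intro sum_emeasure disjoint_family_on_mono[OF _ disjoint_atoms]) auto
  ultimately show ?thesis by simp
qed

text \<open>
  Integrate \<open>2 * c * (h - 1) - c\<^sup>2 \<le> (h - 1)\<^sup>2\<close> over \<open>B\<close>, where \<open>c\<close> is the mean of \<open>h - 1\<close> on \<open>B\<close>.
\<close>

lemma chi_square_le_integral:
  assumes h: "h \<in> borel_measurable \<mu>" "\<And>x. x \<in> space \<mu> \<Longrightarrow> 0 \<le> h x"
    and \<Lambda>: "\<Lambda> = density \<mu> (\<lambda>x. ennreal (h x))"
    and B: "B \<in> sets \<mu>" "emeasure \<mu> B \<noteq> \<infinity>" "emeasure \<Lambda> B \<noteq> \<infinity>"
  shows "ennreal ((measure \<Lambda> B - measure \<mu> B)\<^sup>2 / measure \<mu> B) \<le>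
    (\<integral>\<^sup>+x. ennreal ((h x - 1)\<^sup>2) * indicator B x \<partial>\<mu>)" (is "_ \<le> ?R")
proof (cases "measure \<mu> B = 0 \<or> ?R = \<infinity>")
  case True
  \<comment> \<open>For \<open>measure \<mu> B = 0\<close> the left-hand side is 0, because division
    by 0 yields 0.\<close>
  then show ?thesis by auto
next
  case False
  note [measurable] = h(1) B(1)
  define l m where "l = measure \<Lambda> B" and "m = measure \<mu> B"
  have m: "0 < m" using False by (simp add: m_def zero_less_measure_iff)
  define c where "c = (l - m) / m"
  have R: "?R = (\<integral>\<^sup>+x. ennreal (indicator B x * (h x - 1)\<^sup>2) \<partial>\<mu>)"
    by (intro nn_integral_cong) (auto simp: indicator_def)
  have int1: "integrable \<mu> (\<lambda>x. indicator B x * (h x - 1)\<^sup>2)"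
    using False unfolding R
    by (intro integrableI_nonneg) (auto simp: top.not_eq_extremum)
  have \<Lambda>B: "emeasure \<Lambda> B = (\<integral>\<^sup>+x. ennreal (indicator B x * h x) \<partial>\<mu>)"
    unfolding \<Lambda> by (subst emeasure_density) (auto intro!: nn_integral_cong simp: indicator_def)
  have int2: "integrable \<mu> (\<lambda>x. indicator B x * h x)"
    using B(3) h(2) unfolding \<Lambda>B
    by (intro integrableI_nonneg) (auto simp: top.not_eq_extremum intro!: AE_I2)
  have l: "(\<integral>x. indicator B x * h x \<partial>\<mu>) = l"
    using h(2) unfolding l_def measure_def \<Lambda>B by (intro integral_eq_nn_integral) (auto intro!: AE_I2)
  have int3: "integrable \<mu> (indicator B :: _ \<Rightarrow> real)"
    using B by (intro integrable_real_indicator) (auto simp: top.not_eq_extremum)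
  have "(l - m)\<^sup>2 / m = 2 * c * l - (2 * c + c\<^sup>2) * m"
    using m by (simp add: c_def power2_eq_square field_simps)
  also have "\<dots> = (\<integral>x. 2 * c * (indicator B x * h x) - (2 * c + c\<^sup>2) * indicator B x \<partial>\<mu>)"
    using int2 int3 by (simp add: l m_def)
  also have "\<dots> \<le> (\<integral>x. indicator B x * (h x - 1)\<^sup>2 \<partial>\<mu>)"
  proof (rule integral_mono)
    fix x
    have "0 \<le> (h x - 1 - c)\<^sup>2" by simp
    then have "2 * c * h x - (2 * c + c\<^sup>2) \<le> (h x - 1)\<^sup>2"
      by (simp add: power2_eq_square algebra_simps)
    then show "2 * c * (indicator B x * h x) - (2 * c + c\<^sup>2) * indicator B x \<le> indicator B x * (h x - 1)\<^sup>2"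
      by (simp add: indicator_def)
  qed (use int1 int2 int3 in auto)
  finally have "ennreal ((l - m)\<^sup>2 / m) \<le> ennreal (\<integral>x. indicator B x * (h x - 1)\<^sup>2 \<partial>\<mu>)"
    by (rule ennreal_leI)
  also have "\<dots> = ?R"
    unfolding R using int1 by (intro nn_integral_eq_integral[symmetric]) auto
  finally show ?thesis by (simp add: l_def m_def)
qed

text \<open>The generating function at \<open>(l / m)\<^sup>2\<close> contributes
  \<open>l\<^sup>2 / m - m\<close>, and adding \<open>2 * (m - l)\<close> completes the square. The
  resulting chi-square term is what \<open>chi_square_le_integral\<close> controls.\<close>

lemma nn_integral_poisson_lr_square:
  assumes l: "0 \<le> l" and m: "0 \<le> m" and ac: "m = 0 \<Longrightarrow> l = 0"
  shows "(\<integral>\<^sup>+x. (poisson_lr l m x)\<^sup>2 \<partial>poisson_law (ennreal m)) = ennreal (exp ((l - m)\<^sup>2 / m))"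
proof -
  have "(\<integral>\<^sup>+x. (poisson_lr l m x)\<^sup>2 \<partial>poisson_law (ennreal m)) =
      (\<integral>\<^sup>+x. ennreal (exp (2 * (m - l))) * ennreal (((l / m)\<^sup>2) ^ count_of x) \<partial>poisson_law (ennreal m))"
    using l m unfolding poisson_lr_def
    by (intro nn_integral_cong)
      (simp add: power2_eq_square ennreal_mult[symmetric] power_mult_distrib[symmetric] mult_ac exp_add[symmetric])
  also have "\<dots> = ennreal (exp (2 * (m - l) + m * ((l / m)\<^sup>2 - 1)))"
    using m by (subst nn_integral_cmult)
      (simp_all add: nn_integral_poisson_law_power ennreal_mult[symmetric] exp_add[symmetric])
  also have "2 * (m - l) + m * ((l / m)\<^sup>2 - 1) = (l - m)\<^sup>2 / m"
    using ac by (cases "m = 0") (simp_all add: power2_eq_square field_simps)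
  finally show ?thesis .
qed

text \<open>The event of no points has probability \<open>exp (- l)\<close>, and
  \<open>1 - exp (- l) \<le> l\<close>.\<close>

lemma poisson_pp_measure_nonzero_le:
  assumes P: "poisson_pp S \<Lambda> P" and E: "E \<in> sets S" "emeasure \<Lambda> E = ennreal l" "0 \<le> l"
  shows "measure P {\<eta> \<in> space P. emeasure \<eta> E \<noteq> 0} \<le> l"
proof -
  interpret prob_space P using P by (simp add: poisson_pp_def)
  have [measurable]: "(\<lambda>\<eta>. emeasure \<eta> E) \<in> borel_measurable P"
    by (rule poisson_pp_measurable_emeasure[OF P E(1)])
  have "emeasure P {\<eta> \<in> space P. emeasure \<eta> E = 0} =
      (\<integral>\<^sup>+\<eta>. indicator {\<eta> \<in> space P. emeasure \<eta> E = 0} \<eta> \<partial>P)"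
    by simp
  also have "\<dots> = (\<integral>\<^sup>+\<eta>. indicator {0} (emeasure \<eta> E) \<partial>P)"
    by (intro nn_integral_cong) (auto simp: indicator_def)
  also have "\<dots> = (\<integral>\<^sup>+x. indicator {0} x \<partial>poisson_law (emeasure \<Lambda> E))"
    by (rule nn_integral_poisson_pp[OF P E(1)]) auto
  also have "\<dots> = (\<Sum>n. ennreal (exp (- l) * l ^ n / fact n) * indicator {0} (of_nat n :: ennreal))"
    unfolding E(2) by (rule nn_integral_poisson_law[OF E(3)]) auto
  also have "\<dots> = (\<Sum>n\<in>{0}. ennreal (exp (- l) * l ^ n / fact n) * indicator {0} (of_nat n :: ennreal))"
    by (rule suminf_finite) (auto simp: indicator_def)
  finally have "prob {\<eta> \<in> space P. emeasure \<eta> E = 0} = exp (- l)"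
    by (simp add: measure_def)
  then have "prob {\<eta> \<in> space P. emeasure \<eta> E \<noteq> 0} = 1 - exp (- l)"
    using prob_neg[of "\<lambda>\<eta>. emeasure \<eta> E = 0"] by simp
  also have "\<dots> \<le> l" using exp_ge_add_one_self[of "- l"] by simp
  finally show ?thesis .
qed

text \<open>With \<open>E\<close> added to the sets of the cylinder, the counts on the atoms are
  independent and decide both the event \<open>A\<close> and whether \<open>E\<close> is free of
  points. Points in \<open>E\<close> account for \<open>measure \<Lambda> E\<close>; in their
  absence the second moment of the likelihood ratio gives the other two terms. The exponent on the
  right does not depend on the cylinder.\<close>

lemma poisson_pp_cylinder_bound:
  assumes P: "poisson_pp S \<Lambda> P" and Q: "poisson_pp S \<mu> Q" and \<mu>: "sets \<mu> = sets S"
    and h: "h \<in> borel_measurable \<mu>" "\<And>x. x \<in> space \<mu> \<Longrightarrow> 0 \<le> h x"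
    and \<Lambda>: "\<Lambda> = density \<mu> (\<lambda>x. ennreal (h x))"
    and E: "E \<in> sets S" "emeasure \<Lambda> E \<noteq> \<infinity>" "emeasure \<mu> E \<noteq> \<infinity>"
    and hK: "\<And>x. x \<in> space \<mu> - E \<Longrightarrow> h x \<le> K" and K: "0 \<le> K"
    and W: "(\<integral>\<^sup>+x. ennreal ((sqrt (h x) - 1)\<^sup>2) \<partial>\<mu>) = ennreal W" "0 \<le> W"
    and A: "A \<in> cylinders S {B \<in> sets S. emeasure \<Lambda> B \<noteq> \<infinity> \<and> emeasure \<mu> B \<noteq> \<infinity>}"
    and t: "0 < t"
  shows "measure P A \<le> measure \<Lambda> E + t * measure Q A + exp ((sqrt K + 1)\<^sup>2 * W + 2 * measure \<mu> E) / t"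
proof -
  interpret P: prob_space P using P by (simp add: poisson_pp_def)
  interpret Q: prob_space Q using Q by (simp add: poisson_pp_def)
  have setsP: "sets P = sets (pp_algebra S)" and setsQ: "sets Q = sets (pp_algebra S)"
    using P Q by (simp_all add: poisson_pp_def)
  have spP: "space P = point_patterns S" and spQ: "space Q = point_patterns S"
    using setsP setsQ by (simp_all add: sets_eq_imp_space_eq space_pp_algebra)
  have sets\<Lambda>: "sets \<Lambda> = sets S" by (simp add: \<Lambda> \<mu>)
  obtain J X where J: "finite J" "J \<subseteq> {B \<in> sets S. emeasure \<Lambda> B \<noteq> \<infinity> \<and> emeasure \<mu> B \<noteq> \<infinity>}"
    and X: "X \<in> sets (\<Pi>\<^sub>M B\<in>J. (borel :: ennreal measure))"
    and A_eq: "A = {\<eta> \<in> point_patterns S. (\<lambda>B\<in>J. emeasure \<eta> B) \<in> X}"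
    using A unfolding cylinders_def by blast
  define J' where "J' = insert E J"
  have J': "finite J'" "J' \<subseteq> sets S" "E \<in> J'" "J \<subseteq> J'"
    and J'fin: "\<And>b. b \<in> J' \<Longrightarrow> emeasure \<Lambda> b \<noteq> \<infinity>" "\<And>b. b \<in> J' \<Longrightarrow> emeasure \<mu> b \<noteq> \<infinity>"
    using J E by (auto simp: J'_def)
  \<comment> \<open>A nonempty pattern places its atom inside some member of \<open>J'\<close>,
    which makes both intensities of the atom finite.\<close>
  define I where "I = Pow J' - {{}}"
  define B where "B = atom S J'"
  define l where "l k = measure \<Lambda> (B k)" for k
  define m where "m k = measure \<mu> (B k)" for k
  have I: "finite I" using J' by (simp add: I_def)
  have B: "B k \<in> sets S" for k unfolding B_def by (rule atom_sets[OF J'(1,2)])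
  have BI: "B ` I \<subseteq> sets S" using B by auto
  have dis: "disjoint_family_on B I"
    unfolding B_def I_def by (rule disjoint_family_on_mono[OF _ disjoint_atoms]) auto
  have fin: "emeasure \<Lambda> (B k) \<noteq> \<infinity>" "emeasure \<mu> (B k) \<noteq> \<infinity>" if k: "k \<in> I" for k
  proof -
    obtain b where b: "b \<in> k" "b \<in> J'" using k unfolding I_def by blast
    then have "B k \<subseteq> b" unfolding B_def by (intro atom_subset)
    then have "emeasure \<Lambda> (B k) \<le> emeasure \<Lambda> b" "emeasure \<mu> (B k) \<le> emeasure \<mu> b"
      using b J'(2) sets\<Lambda> \<mu> by (auto intro!: emeasure_mono)
    then show "emeasure \<Lambda> (B k) \<noteq> \<infinity>" "emeasure \<mu> (B k) \<noteq> \<infinity>"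
      using J'fin[OF b(2)] by (auto simp: top_unique)
  qed
  have em: "emeasure \<mu> (B k) = ennreal (m k)" if "k \<in> I" for k
    using fin[OF that] by (simp add: m_def emeasure_eq_ennreal_measure)
  have l0: "0 \<le> l k" and m0: "0 \<le> m k" for k by (simp_all add: l_def m_def)
  have "absolutely_continuous \<mu> \<Lambda>"
    unfolding \<Lambda> using h(1) by (intro absolutely_continuousI_density) simp
  then have ac: "l k = 0" if "k \<in> I" "m k = 0" for k
  proof -
    have "B k \<in> null_sets \<mu>" using em[OF that(1)] that(2) B \<mu> by (simp add: null_sets_def)
    then have "B k \<in> null_sets \<Lambda>" using \<open>absolutely_continuous \<mu> \<Lambda>\<close> by (auto simp: absolutely_continuous_def)
    then show ?thesis by (simp add: l_def null_sets_def measure_def)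
  qed
  have sum_atoms: "emeasure M b = (\<Sum>k | k \<in> I \<and> b \<in> k. emeasure M (B k))"
    if "sets M = sets S" "b \<in> J'" for M b
    unfolding I_def B_def by (rule emeasure_sum_atoms[OF J'(1,2) that(2,1)])
  let ?M = "\<Pi>\<^sub>M k\<in>I. (borel :: ennreal measure)"
  \<comment> \<open>The map \<open>T\<close> recovers the counts on \<open>J\<close> from those on
    the atoms; \<open>X'\<close> then describes, in terms of atoms, the part of \<open>A\<close> on
    which \<open>E\<close> has no points.\<close>
  define T where "T v = (\<lambda>b\<in>J. \<Sum>k | k \<in> I \<and> b \<in> k. v k)" for v :: "'a set set \<Rightarrow> ennreal"
  define X' where "X' = (T -` X \<inter> space ?M) \<inter> {v \<in> space ?M. \<forall>k\<in>{k \<in> I. E \<in> k}. v k = 0}"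
  have "T \<in> ?M \<rightarrow>\<^sub>M (\<Pi>\<^sub>M b\<in>J. borel)"
    unfolding T_def
    by (intro measurable_restrict borel_measurable_sum measurable_component_singleton) auto
  moreover have "{v \<in> space ?M. \<forall>k\<in>{k \<in> I. E \<in> k}. v k = 0} \<in> sets ?M"
  proof (rule sets.sets_Collect_finite_All)
    fix k assume "k \<in> {k \<in> I. E \<in> k}"
    then have "(\<lambda>v. v k) \<in> borel_measurable ?M" by (intro measurable_component_singleton) auto
    then show "{v \<in> space ?M. v k = 0} \<in> sets ?M" by measurable
  qed (use I in auto)
  ultimately have X': "X' \<in> sets ?M" unfolding X'_def using X by (intro sets.Int measurable_sets)
  let ?Y = "\<lambda>\<eta>. \<lambda>k\<in>I. emeasure \<eta> (B k)"
  have TY: "T (?Y \<eta>) = (\<lambda>b\<in>J. emeasure \<eta> b)" and YE: "(\<forall>k\<in>{k \<in> I. E \<in> k}. ?Y \<eta> k = 0) \<longleftrightarrow> emeasure \<eta> E = 0"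
    if "\<eta> \<in> point_patterns S" for \<eta>
  proof -
    have s: "sets \<eta> = sets S" using that by (simp add: point_patterns_def)
    show "T (?Y \<eta>) = (\<lambda>b\<in>J. emeasure \<eta> b)"
      unfolding T_def
    proof (rule restrict_ext)
      fix b assume "b \<in> J"
      then have "b \<in> J'" using J'(4) by auto
      from sum_atoms[OF s this] show "(\<Sum>k | k \<in> I \<and> b \<in> k. ?Y \<eta> k) = emeasure \<eta> b"
        by (auto intro: sum.cong)
    qed
    show "(\<forall>k\<in>{k \<in> I. E \<in> k}. ?Y \<eta> k = 0) \<longleftrightarrow> emeasure \<eta> E = 0"
      unfolding sum_atoms[OF s J'(3)] using I by (subst sum_eq_0_iff) auto
  qed
  have YX': "?Y \<eta> \<in> X' \<longleftrightarrow> \<eta> \<in> A \<and> emeasure \<eta> E = 0" if "\<eta> \<in> point_patterns S" for \<eta>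
    using TY[OF that] YE[OF that] that unfolding X'_def A_eq by (auto simp: space_PiM)

  \<comment> \<open>The squared likelihood ratio, cut down to count 0 on atoms inside
    \<open>E\<close>. At count 0 it is \<open>exp (2 * (m k - l k))\<close>, at most
    \<open>exp (2 * m k)\<close>, however large \<open>h\<close> is on \<open>E\<close>. This
    explains the two cases of the exponent \<open>c\<close> below.\<close>
  define \<psi> where "\<psi> k x = (poisson_lr (l k) (m k) x)\<^sup>2 * (if E \<in> k then indicator {0} x else 1)"
    for k and x :: ennreal
  have \<psi>_meas [measurable]: "\<psi> k \<in> borel_measurable borel" for k
    unfolding \<psi>_def by measurable
  define c where "c k = (if E \<in> k then 2 * m k else (l k - m k)\<^sup>2 / m k)" for k
  have c0: "0 \<le> c k" for k using m0 by (simp add: c_def)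
  have \<psi>_int: "(\<integral>\<^sup>+x. \<psi> k x \<partial>poisson_law (emeasure \<mu> (B k))) \<le> ennreal (exp (c k))" if k: "k \<in> I" for k
  proof (cases "E \<in> k")
    case False
    then show ?thesis
      using nn_integral_poisson_lr_square[OF l0[of k] m0[of k]] ac[OF k] by (simp add: \<psi>_def c_def em[OF k])
  next
    case True
    have "exp (m k - l k) * exp (m k - l k) \<le> exp (2 * m k)"
      using l0[of k] by (simp add: exp_add[symmetric])
    then have "\<psi> k x \<le> ennreal (exp (2 * m k))" for x
      using True by (auto simp: \<psi>_def poisson_lr_def indicator_def count_of_def power2_eq_square
        ennreal_mult[symmetric] intro!: ennreal_leI)
    then have "(\<integral>\<^sup>+x. \<psi> k x \<partial>poisson_law (emeasure \<mu> (B k))) \<le>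
        (\<integral>\<^sup>+x. ennreal (exp (2 * m k)) \<partial>poisson_law (emeasure \<mu> (B k)))"
      by (intro nn_integral_mono)
    also have "\<dots> = ennreal (exp (2 * m k))"
      using prob_space.emeasure_space_1[OF prob_space_poisson_law] by simp
    finally show ?thesis using True by (simp add: c_def)
  qed

  \<comment> \<open>Off \<open>E\<close> the factorisation
    \<open>h - 1 = (sqrt h + 1) * (sqrt h - 1)\<close> and \<open>h \<le> K\<close> bound the
    chi-square terms by integrals over disjoint atoms, hence by one integral over the whole space.
    The atoms inside \<open>E\<close> add up to the mass of \<open>E\<close>.\<close>
  have sum_c: "(\<Sum>k\<in>I. c k) \<le> (sqrt K + 1)\<^sup>2 * W + 2 * measure \<mu> E"
  proof -
    let ?G = "\<lambda>x. ennreal ((sqrt K + 1)\<^sup>2) * ennreal ((sqrt (h x) - 1)\<^sup>2)"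
    have [measurable]: "h \<in> borel_measurable \<mu>" by (rule h(1))
    have Bm [measurable]: "B k \<in> sets \<mu>" for k using B \<mu> by simp
    have chi: "ennreal ((l k - m k)\<^sup>2 / m k) \<le> (\<integral>\<^sup>+x. ?G x * indicator (B k) x \<partial>\<mu>)"
      if k: "k \<in> I" "E \<notin> k" for k
    proof -
      have "ennreal ((l k - m k)\<^sup>2 / m k) \<le> (\<integral>\<^sup>+x. ennreal ((h x - 1)\<^sup>2) * indicator (B k) x \<partial>\<mu>)"
        unfolding l_def m_def by (rule chi_square_le_integral[OF h \<Lambda> Bm fin(2,1)[OF k(1)]])
      also have "\<dots> \<le> (\<integral>\<^sup>+x. ?G x * indicator (B k) x \<partial>\<mu>)"
      proof (rule nn_integral_mono)
        fix x assume x: "x \<in> space \<mu>"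
        have "(h x - 1)\<^sup>2 \<le> (sqrt K + 1)\<^sup>2 * (sqrt (h x) - 1)\<^sup>2" if "x \<in> B k"
        proof -
          have "x \<notin> E" using that k(2) J'(3) by (auto simp: B_def atom_def)
          then have hx: "0 \<le> h x" "h x \<le> K" using x h(2) hK by auto
          have "h x - 1 = (sqrt (h x) + 1) * (sqrt (h x) - 1)"
            using hx by (simp add: algebra_simps)
          then have "(h x - 1)\<^sup>2 = (sqrt (h x) + 1)\<^sup>2 * (sqrt (h x) - 1)\<^sup>2"
            by (metis power_mult_distrib)
          also have "\<dots> \<le> (sqrt K + 1)\<^sup>2 * (sqrt (h x) - 1)\<^sup>2"
            using hx by (intro mult_right_mono power_mono) auto
          finally show ?thesis .
        qed
        then show "ennreal ((h x - 1)\<^sup>2) * indicator (B k) x \<le> ?G x * indicator (B k) x"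
          by (auto simp: indicator_def ennreal_mult[symmetric] intro!: ennreal_leI)
      qed
      finally show ?thesis .
    qed
    have "ennreal (\<Sum>k | k \<in> I \<and> E \<notin> k. (l k - m k)\<^sup>2 / m k) =
        (\<Sum>k | k \<in> I \<and> E \<notin> k. ennreal ((l k - m k)\<^sup>2 / m k))"
      using m0 by (intro sum_ennreal[symmetric]) auto
    also have "\<dots> \<le> (\<Sum>k | k \<in> I \<and> E \<notin> k. \<integral>\<^sup>+x. ?G x * indicator (B k) x \<partial>\<mu>)"
      using chi by (intro sum_mono) auto
    also have "\<dots> = (\<integral>\<^sup>+x. (\<Sum>k | k \<in> I \<and> E \<notin> k. ?G x * indicator (B k) x) \<partial>\<mu>)"
      by (intro nn_integral_sum[symmetric]) auto
    also have "\<dots> = (\<integral>\<^sup>+x. ?G x * indicator (\<Union>k\<in>{k. k \<in> I \<and> E \<notin> k}. B k) x \<partial>\<mu>)"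
    proof (rule nn_integral_cong)
      fix x
      have "(\<Sum>k | k \<in> I \<and> E \<notin> k. indicator (B k) x :: ennreal) = indicator (\<Union>k\<in>{k. k \<in> I \<and> E \<notin> k}. B k) x"
        using I dis by (intro indicator_UN_disjoint[symmetric] disjoint_family_on_mono[OF _ dis]) auto
      then show "(\<Sum>k | k \<in> I \<and> E \<notin> k. ?G x * indicator (B k) x) =
          ?G x * indicator (\<Union>k\<in>{k. k \<in> I \<and> E \<notin> k}. B k) x"
        by (simp add: sum_distrib_left[symmetric])
    qed
    also have "\<dots> \<le> (\<integral>\<^sup>+x. ?G x \<partial>\<mu>)"
      by (intro nn_integral_mono) (auto simp: indicator_def)
    also have "\<dots> = ennreal ((sqrt K + 1)\<^sup>2 * W)"
      using W(2) by (simp add: nn_integral_cmult W(1) ennreal_mult)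
    finally have 1: "(\<Sum>k | k \<in> I \<and> E \<notin> k. (l k - m k)\<^sup>2 / m k) \<le> (sqrt K + 1)\<^sup>2 * W"
      using W(2) by (simp add: ennreal_le_iff)
    have "ennreal (\<Sum>k | k \<in> I \<and> E \<in> k. m k) = (\<Sum>k | k \<in> I \<and> E \<in> k. ennreal (m k))"
      using m0 by (intro sum_ennreal[symmetric]) auto
    also have "\<dots> = emeasure \<mu> E"
      unfolding sum_atoms[OF \<mu> J'(3)] by (intro sum.cong refl em[symmetric]) auto
    finally have 2: "(\<Sum>k | k \<in> I \<and> E \<in> k. m k) = measure \<mu> E"
      using m0 by (simp add: measure_def sum_nonneg flip: \<open>_ = emeasure \<mu> E\<close>)
    have "(\<Sum>k\<in>I. c k) = (\<Sum>k | k \<in> I \<and> E \<in> k. 2 * m k) + (\<Sum>k | k \<in> I \<and> E \<notin> k. (l k - m k)\<^sup>2 / m k)"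
      unfolding c_def using I by (simp add: sum.If_cases Int_def)
    also have "(\<Sum>k | k \<in> I \<and> E \<in> k. 2 * m k) = 2 * measure \<mu> E"
      by (simp add: sum_distrib_left[symmetric] 2)
    finally show ?thesis using 1 by simp
  qed

  define C where "C = (sqrt K + 1)\<^sup>2 * W + 2 * measure \<mu> E"
  let ?L = "\<lambda>\<eta>. \<Prod>k\<in>I. poisson_lr (l k) (m k) (emeasure \<eta> (B k))"
  let ?\<Psi> = "\<lambda>\<eta>. \<Prod>k\<in>I. \<psi> k (emeasure \<eta> (B k))"
  have Am: "A \<in> sets P" "A \<in> sets Q"
  proof -
    have "(\<lambda>\<eta>. \<lambda>B\<in>J. emeasure \<eta> B) \<in> pp_algebra S \<rightarrow>\<^sub>M (\<Pi>\<^sub>M B\<in>J. borel)"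
      using J by (intro measurable_restrict measurable_emeasure_pp_algebra) auto
    from measurable_sets[OF this X] have "A \<in> sets (pp_algebra S)"
      by (simp add: A_eq space_pp_algebra vimage_def Int_def conj_commute)
    then show "A \<in> sets P" "A \<in> sets Q" using setsP setsQ by simp_all
  qed
  have \<Psi>m: "?\<Psi> \<in> borel_measurable Q"
    by (intro borel_measurable_prod_ennreal measurable_compose[OF poisson_pp_measurable_emeasure[OF Q B]] \<psi>_meas)
  have [measurable]: "(\<lambda>\<eta>. emeasure \<eta> E) \<in> borel_measurable P"
    by (rule poisson_pp_measurable_emeasure[OF P E(1)])
  have "emeasure P {\<eta> \<in> space P. ?Y \<eta> \<in> X'} = (\<integral>\<^sup>+\<eta>. ?L \<eta> * indicator X' (?Y \<eta>) \<partial>Q)"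
    unfolding l_def m_def
    by (rule poisson_pp_change_of_measure[OF P Q I BI dis fin _ X'])
      (use ac in \<open>auto simp: l_def m_def\<close>)
  also have "\<dots> \<le> (\<integral>\<^sup>+\<eta>. ennreal t * indicator A \<eta> + ennreal (1 / t) * ?\<Psi> \<eta> \<partial>Q)"
  proof (rule nn_integral_mono)
    fix \<eta> assume "\<eta> \<in> space Q"
    then have \<eta>: "\<eta> \<in> point_patterns S" by (simp add: spQ)
    show "?L \<eta> * indicator X' (?Y \<eta>) \<le> ennreal t * indicator A \<eta> + ennreal (1 / t) * ?\<Psi> \<eta>"
    proof (cases "?Y \<eta> \<in> X'")
      case True
      then have "\<eta> \<in> A" "emeasure \<eta> E = 0" using YX'[OF \<eta>] by auto
      with YE[OF \<eta>] have "?\<Psi> \<eta> = (?L \<eta>)\<^sup>2"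
        unfolding \<psi>_def prod_power_distrib by (intro prod.cong) auto
      moreover define L where "L = (\<Prod>k\<in>I. exp (m k - l k) * (l k / m k) ^ count_of (emeasure \<eta> (B k)))"
      have "?L \<eta> = ennreal L"
        unfolding L_def poisson_lr_def using l0 m0 by (intro prod_ennreal) auto
      moreover have L0: "0 \<le> L" unfolding L_def using l0 m0 by (intro prod_nonneg) auto
      moreover have "L \<le> t + 1 / t * L\<^sup>2"
      proof -
        have "0 \<le> (L - t)\<^sup>2 + t * L" using t L0 by auto
        then have "t * L \<le> t * t + L\<^sup>2" by (simp add: power2_eq_square algebra_simps)
        then show ?thesis using t by (simp add: field_simps)
      qed
      then have "ennreal L \<le> ennreal t + ennreal (1 / t) * (ennreal L)\<^sup>2"
        using t L0 by (simp add: ennreal_power ennreal_mult[symmetric] ennreal_plus[symmetric]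
          ennreal_le_iff del: ennreal_plus)
      ultimately show ?thesis using True \<open>\<eta> \<in> A\<close> by simp
    qed simp
  qed
  also have "\<dots> = ennreal t * emeasure Q A + ennreal (1 / t) * (\<integral>\<^sup>+\<eta>. ?\<Psi> \<eta> \<partial>Q)"
    using Am \<Psi>m by (simp add: nn_integral_add nn_integral_cmult)
  also have "(\<integral>\<^sup>+\<eta>. ?\<Psi> \<eta> \<partial>Q) = (\<Prod>k\<in>I. \<integral>\<^sup>+x. \<psi> k x \<partial>poisson_law (emeasure \<mu> (B k)))"
    by (rule nn_integral_poisson_pp_prod[OF Q I BI dis \<psi>_meas])
  also have "ennreal t * emeasure Q A + ennreal (1 / t) * \<dots> \<le>
      ennreal t * emeasure Q A + ennreal (1 / t) * (\<Prod>k\<in>I. ennreal (exp (c k)))"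
    using \<psi>_int by (intro add_left_mono mult_left_mono prod_mono_ennreal) auto
  also have "(\<Prod>k\<in>I. ennreal (exp (c k))) = ennreal (exp (\<Sum>k\<in>I. c k))"
    using I by (simp add: prod_ennreal exp_sum)
  also have "ennreal t * emeasure Q A + ennreal (1 / t) * \<dots> \<le>
      ennreal t * emeasure Q A + ennreal (1 / t) * ennreal (exp C)"
    using sum_c by (intro add_left_mono mult_left_mono ennreal_leI) (auto simp: C_def)
  also have "\<dots> = ennreal (t * measure Q A + exp C / t)"
    using t by (simp add: Q.emeasure_eq_measure ennreal_mult[symmetric])
  finally have "measure P {\<eta> \<in> space P. ?Y \<eta> \<in> X'} \<le> t * measure Q A + exp C / t"
    unfolding P.emeasure_eq_measure by (subst (asm) ennreal_le_iff) (use t in auto)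
  moreover have "measure P A \<le> measure P ({\<eta> \<in> space P. ?Y \<eta> \<in> X'} \<union> {\<eta> \<in> space P. emeasure \<eta> E \<noteq> 0})"
  proof (rule P.finite_measure_mono)
    have "{\<eta> \<in> space P. ?Y \<eta> \<in> X'} = {\<eta> \<in> A. emeasure \<eta> E = 0}"
      using YX' sets.sets_into_space[OF Am(1)] by (auto simp: spP)
    also have "\<dots> = A \<inter> {\<eta> \<in> space P. emeasure \<eta> E = 0}"
      using sets.sets_into_space[OF Am(1)] by auto
    finally have eq: "{\<eta> \<in> space P. ?Y \<eta> \<in> X'} = A \<inter> {\<eta> \<in> space P. emeasure \<eta> E = 0}" .
    show "A \<subseteq> {\<eta> \<in> space P. ?Y \<eta> \<in> X'} \<union> {\<eta> \<in> space P. emeasure \<eta> E \<noteq> 0}"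
      unfolding eq using sets.sets_into_space[OF Am(1)] by auto
    show "{\<eta> \<in> space P. ?Y \<eta> \<in> X'} \<union> {\<eta> \<in> space P. emeasure \<eta> E \<noteq> 0} \<in> sets P"
      unfolding eq using Am(1) by measurable
  qed
  moreover have "\<dots> \<le> measure P {\<eta> \<in> space P. ?Y \<eta> \<in> X'} + measure P {\<eta> \<in> space P. emeasure \<eta> E \<noteq> 0}"
  proof (rule measure_Un_le)
    have "{\<eta> \<in> space P. ?Y \<eta> \<in> X'} = ?Y -` X' \<inter> space P" by auto
    also have "\<dots> \<in> sets P"
      by (rule measurable_sets[OF measurable_restrict X']) (rule poisson_pp_measurable_emeasure[OF P B])
    finally show "{\<eta> \<in> space P. ?Y \<eta> \<in> X'} \<in> sets P" .
  qed measurable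
  moreover have "measure P {\<eta> \<in> space P. emeasure \<eta> E \<noteq> 0} \<le> measure \<Lambda> E"
    using E(2) by (intro poisson_pp_measure_nonzero_le[OF P E(1)]) (simp_all add: emeasure_eq_ennreal_measure)
  ultimately show ?thesis unfolding C_def by linarith
qed

section \<open>Absolute continuity when the Hellinger integral is finite\<close>

lemma sigma_finite_common_partition:
  assumes "sigma_finite_measure M" "sigma_finite_measure N" "sets M = sets S" "sets N = sets S"
  obtains D :: "nat \<Rightarrow> 'a set" where "disjoint_family D" "(\<Union>i. D i) = space S" "range D \<subseteq> sets S"
    "\<And>i. emeasure M (D i) \<noteq> \<infinity>" "\<And>i. emeasure N (D i) \<noteq> \<infinity>"
proof -
  have sp: "space M = space S" "space N = space S"
    using assms(3,4) by (auto dest: sets_eq_imp_space_eq)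
  obtain A :: "nat \<Rightarrow> 'a set" where A: "range A \<subseteq> sets M" "(\<Union>i. A i) = space M"
    "\<And>i. emeasure M (A i) \<noteq> \<infinity>" "disjoint_family A"
    using sigma_finite_measure.sigma_finite_disjoint[OF assms(1)] by metis
  obtain B :: "nat \<Rightarrow> 'a set" where B: "range B \<subseteq> sets N" "(\<Union>i. B i) = space N"
    "\<And>i. emeasure N (B i) \<noteq> \<infinity>" "disjoint_family B"
    using sigma_finite_measure.sigma_finite_disjoint[OF assms(2)] by metis
  have AS: "A i \<in> sets S" "B i \<in> sets S" for i using A(1) B(1) assms(3,4) by auto
  \<comment> \<open>The common refinement of the two partitions, with pairs of indices enumerated by
    \<open>prod_decode\<close>.\<close>
  define D where "D n = A (fst (prod_decode n)) \<inter> B (snd (prod_decode n))" for n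
  show thesis
  proof
    show "disjoint_family D"
      unfolding disjoint_family_on_def
    proof (intro ballI impI)
      fix m n :: nat assume "m \<noteq> n"
      then have "prod_decode m \<noteq> prod_decode n" by (metis prod_decode_inverse)
      then have "fst (prod_decode m) \<noteq> fst (prod_decode n) \<or> snd (prod_decode m) \<noteq> snd (prod_decode n)"
        by (auto simp: prod_eq_iff)
      then show "D m \<inter> D n = {}"
        using A(4) B(4) unfolding D_def disjoint_family_on_def by blast
    qed
    have "x \<in> (\<Union>i. D i)" if x: "x \<in> space S" for x
    proof -
      obtain i j where "x \<in> A i" "x \<in> B j" using x A(2) B(2) sp by blast
      then have "x \<in> D (prod_encode (i, j))" by (simp add: D_def)
      then show ?thesis by blast
    qed
    moreover have "D i \<subseteq> space S" for i
      using AS sets.sets_into_space[of "A (fst (prod_decode i))" S] by (auto simp: D_def)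
    ultimately show "(\<Union>i. D i) = space S" by blast
    show "range D \<subseteq> sets S" using AS by (auto simp: D_def)
    show "emeasure M (D i) \<noteq> \<infinity>" "emeasure N (D i) \<noteq> \<infinity>" for i
    proof -
      have "emeasure M (D i) \<le> emeasure M (A (fst (prod_decode i)))"
        using AS assms(3) by (intro emeasure_mono) (auto simp: D_def)
      then show "emeasure M (D i) \<noteq> \<infinity>" using A(3)[of "fst (prod_decode i)"] by (auto simp: top_unique)
      have "emeasure N (D i) \<le> emeasure N (B (snd (prod_decode i)))"
        using AS assms(4) by (intro emeasure_mono) (auto simp: D_def)
      then show "emeasure N (D i) \<noteq> \<infinity>" using B(3)[of "snd (prod_decode i)"] by (auto simp: top_unique)
    qed
  qed
qed

lemma poisson_pp_absolutely_continuous: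
  assumes P: "poisson_pp S \<Lambda> P" and Q: "poisson_pp S \<mu> Q" and \<mu>: "sets \<mu> = sets S"
    and sf: "sigma_finite_measure \<Lambda>" "sigma_finite_measure \<mu>"
    and h: "h \<in> borel_measurable \<mu>" "\<And>x. x \<in> space \<mu> \<Longrightarrow> 0 \<le> h x"
    and \<Lambda>: "\<Lambda> = density \<mu> (\<lambda>x. ennreal (h x))"
    and fin: "(\<integral>\<^sup>+x. ennreal ((sqrt (h x) - 1)\<^sup>2) \<partial>\<mu>) < \<infinity>"
  shows "absolutely_continuous Q P"
proof -
  interpret P: prob_space P using P by (simp add: poisson_pp_def)
  interpret Q: prob_space Q using Q by (simp add: poisson_pp_def)
  note [measurable] = h(1)
  have sets\<Lambda>: "sets \<Lambda> = sets S" by (simp add: \<Lambda> \<mu>)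
  obtain D :: "nat \<Rightarrow> 'a set" where D: "disjoint_family D" "(\<Union>i. D i) = space S" "range D \<subseteq> sets S"
    "\<And>i. emeasure \<Lambda> (D i) \<noteq> \<infinity>" "\<And>i. emeasure \<mu> (D i) \<noteq> \<infinity>"
    using sigma_finite_common_partition[OF sf sets\<Lambda> \<mu>] by blast
  define F where "F = {B \<in> sets S. emeasure \<Lambda> B \<noteq> \<infinity> \<and> emeasure \<mu> B \<noteq> \<infinity>}"
  have FD: "B \<inter> D i \<in> F" if "B \<in> sets S" for B i
  proof -
    have Di: "D i \<in> sets S" using D(3) by auto
    have "emeasure \<Lambda> (B \<inter> D i) \<le> emeasure \<Lambda> (D i)" "emeasure \<mu> (B \<inter> D i) \<le> emeasure \<mu> (D i)"
      using Di sets\<Lambda> \<mu> by (auto intro!: emeasure_mono)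
    then show ?thesis using D(4,5)[of i] that Di by (auto simp: F_def top_unique)
  qed
  have gen: "sets (pp_algebra S) = sigma_sets (point_patterns S) (cylinders S F)"
    by (rule sets_pp_algebra_cylinders[OF _ D(1,2,3) FD]) (auto simp: F_def)
  obtain W where W: "(\<integral>\<^sup>+x. ennreal ((sqrt (h x) - 1)\<^sup>2) \<partial>\<mu>) = ennreal W" "0 \<le> W"
    using fin by (cases "\<integral>\<^sup>+x. ennreal ((sqrt (h x) - 1)\<^sup>2) \<partial>\<mu>") auto
  \<comment> \<open>The offset 4 gives \<open>sqrt (h x) \<ge> 2\<close> on \<open>E n\<close>,
    hence \<open>h x \<le> 4 * (sqrt (h x) - 1)\<^sup>2\<close>, so \<Lambda> is finite there; and
    since \<open>h\<close> is at least 1 there, \<mu> is finite too.\<close>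
  define E where "E n = {x \<in> space \<mu>. real n + 4 < h x}" for n :: nat
  have E\<mu> [measurable]: "E n \<in> sets \<mu>" for n unfolding E_def by measurable
  have em\<Lambda>: "emeasure \<Lambda> (E n) = (\<integral>\<^sup>+x. ennreal (h x) * indicator (E n) x \<partial>\<mu>)" for n
    unfolding \<Lambda> by (rule emeasure_density) auto
  have fin\<Lambda>: "emeasure \<Lambda> (E n) \<noteq> \<infinity>" for n
  proof -
    have "emeasure \<Lambda> (E n) \<le> (\<integral>\<^sup>+x. ennreal 4 * ennreal ((sqrt (h x) - 1)\<^sup>2) \<partial>\<mu>)"
      unfolding em\<Lambda>
    proof (rule nn_integral_mono)
      fix x
      have "h x \<le> 4 * (sqrt (h x) - 1)\<^sup>2" if "x \<in> E n"
      proof -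
        have hx: "4 < h x" using that by (simp add: E_def)
        then have "2 \<le> sqrt (h x)" by (intro real_le_rsqrt) auto
        then have "(sqrt (h x))\<^sup>2 \<le> (2 * (sqrt (h x) - 1))\<^sup>2"
          using hx by (intro power_mono) auto
        also have "(2 * (sqrt (h x) - 1))\<^sup>2 = 4 * (sqrt (h x) - 1)\<^sup>2"
          by (subst power_mult_distrib) simp
        finally show ?thesis using hx by simp
      qed
      then show "ennreal (h x) * indicator (E n) x \<le> ennreal 4 * ennreal ((sqrt (h x) - 1)\<^sup>2)"
        by (auto simp: indicator_def ennreal_mult[symmetric] intro!: ennreal_leI simp del: ennreal_numeral)
    qed
    also have "\<dots> = ennreal (4 * W)"
      using W(2) by (simp add: nn_integral_cmult W(1) ennreal_mult)
    finally show ?thesis by (auto simp: top_unique)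
  qed
  have fin\<mu>: "emeasure \<mu> (E n) \<noteq> \<infinity>" for n
  proof -
    have "emeasure \<mu> (E n) = (\<integral>\<^sup>+x. indicator (E n) x \<partial>\<mu>)" by simp
    also have "\<dots> \<le> emeasure \<Lambda> (E n)"
      unfolding em\<Lambda>
      by (intro nn_integral_mono) (auto simp: indicator_def E_def)
    finally show ?thesis using fin\<Lambda>[of n] by (auto simp: top_unique)
  qed
  \<comment> \<open>As \<open>h\<close> is real-valued, the level sets decrease to the empty set;
    their \<Lambda>-masses are finite and therefore tend to 0.\<close>
  have "decseq E" by (auto simp: decseq_def E_def)
  moreover have "(\<Inter>n. E n) = {}"
  proof -
    have "\<exists>n. \<not> real n + 4 < h x" for x using reals_Archimedean2[of "h x"]
      by (metis add_increasing2 linorder_not_less order_less_imp_le zero_le_numeral)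
    then show ?thesis by (auto simp: E_def)
  qed
  ultimately have "(\<lambda>n. emeasure \<Lambda> (E n)) \<longlonglongrightarrow> 0"
    using Lim_emeasure_decseq[of E \<Lambda>] fin\<Lambda> E\<mu> sets\<Lambda> \<mu> by auto
  then have lim: "(\<lambda>n. measure \<Lambda> (E n)) \<longlonglongrightarrow> 0"
    unfolding measure_def by (intro tendsto_enn2real) simp_all
  show ?thesis
  proof (rule absolutely_continuous_of_generating_algebra[OF algebra_cylinders])
    show "finite_measure P" "finite_measure Q" by unfold_locales
    show "sets P = sigma_sets (point_patterns S) (cylinders S F)"
      "sets Q = sigma_sets (point_patterns S) (cylinders S F)"
      using P Q gen by (simp_all add: poisson_pp_def)
    fix e :: real assume e: "0 < e"
    obtain n where n: "measure \<Lambda> (E n) < e / 2"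
      using order_tendstoD(2)[OF lim, of "e / 2"] e by (auto simp: eventually_sequentially)
    \<comment> \<open>Here \<open>n\<close> is already fixed. Since \<open>C\<close> depends on
      \<open>n\<close> but not on the cylinder, one \<open>t\<close> with
      \<open>C / t = e / 2\<close> works for all cylinders.\<close>
    define C where "C = exp ((sqrt (real n + 4) + 1)\<^sup>2 * W + 2 * measure \<mu> (E n))"
    define t where "t = 2 * C / e"
    have t: "0 < t" "C / t = e / 2" using e by (simp_all add: t_def C_def)
    have "measure P B \<le> e + t * measure Q B" if "B \<in> cylinders S F" for B
    proof -
      have "measure P B \<le> measure \<Lambda> (E n) + t * measure Q B + C / t"
        unfolding C_def
        by (rule poisson_pp_cylinder_bound[OF P Q \<mu> h \<Lambda> _ fin\<Lambda> fin\<mu> _ _ W _ t(1)])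
          (use that E\<mu> \<mu> in \<open>auto simp: F_def E_def\<close>)
      then show ?thesis using n t by simp
    qed
    then show "\<exists>t\<ge>0. \<forall>B\<in>cylinders S F. measure P B \<le> e + t * measure Q B"
      using t(1) by (intro exI[of _ t]) auto
  qed
qed

section \<open>The dichotomy\<close>

text \<open>The separating set is \<open>limsup A\<close>. It is \<open>P\<close>-null by
  Borel-Cantelli. Its complement is the union over \<open>n\<close> of the intersections of the
  complements of \<open>A k\<close> for \<open>k \<ge> n\<close>, and each of these has
  \<open>Q\<close>-measure at most \<open>(1/2) ^ k\<close> for all such \<open>k\<close>.\<close>

lemma mutually_singularI:
  assumes sets: "sets P = sets Q"
    and ex: "\<And>n. \<exists>A\<in>sets P. emeasure P A \<le> ennreal ((1/2) ^ n) \<and> emeasure Q (space Q - A) \<le> ennreal ((1/2) ^ n)"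
  shows "mutually_singular P Q"
proof -
  obtain A where A: "\<And>n. A n \<in> sets P" "\<And>n. emeasure P (A n) \<le> ennreal ((1/2) ^ n)"
    "\<And>n. emeasure Q (space Q - A n) \<le> ennreal ((1/2) ^ n)"
    using ex by metis
  have AQ: "A n \<in> sets Q" for n using A(1) sets by auto
  have "limsup A \<in> null_sets P"
  proof (rule borel_cantelli_limsup1)
    show "A n \<in> sets P" for n by (rule A)
    show "emeasure P (A n) < \<infinity>" for n
      using A(2)[of n] by (simp add: le_less_trans)
    have "measure P (A n) \<le> (1/2) ^ n" for n
      unfolding measure_def using A(2)[of n] by (intro enn2real_leI) auto
    then show "summable (\<lambda>n. measure P (A n))"
      by (intro summable_comparison_test'[OF summable_geometric[of "1/2 :: real"]]) auto
  qed
  moreover have "space Q - limsup A \<in> null_sets Q"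
  proof -
    have "(\<Inter>k\<in>{n..}. space Q - A k) \<in> null_sets Q" for n
    proof -
      have m: "(\<Inter>k\<in>{n..}. space Q - A k) \<in> sets Q" using AQ by (intro sets.countable_INT') auto
      have "emeasure Q (\<Inter>k\<in>{n..}. space Q - A k) \<le> 0"
      proof (rule tendsto_lowerbound)
        show "(\<lambda>k. ennreal ((1/2) ^ k)) \<longlonglongrightarrow> 0"
          unfolding ennreal_0[symmetric] by (intro tendsto_ennrealI LIMSEQ_realpow_zero) auto
        have "emeasure Q (\<Inter>k\<in>{n..}. space Q - A k) \<le> ennreal ((1/2) ^ k)" if "n \<le> k" for k
        proof -
          have "emeasure Q (\<Inter>k\<in>{n..}. space Q - A k) \<le> emeasure Q (space Q - A k)"
            using that AQ by (intro emeasure_mono) auto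
          then show ?thesis using A(3)[of k] by (rule order_trans)
        qed
        then show "\<forall>\<^sub>F k in sequentially. emeasure Q (\<Inter>k\<in>{n..}. space Q - A k) \<le> ennreal ((1/2) ^ k)"
          by (auto simp: eventually_sequentially)
      qed simp
      with m show ?thesis by (simp add: null_sets_def)
    qed
    then have "(\<Union>n. \<Inter>k\<in>{n..}. space Q - A k) \<in> null_sets Q" by (intro null_sets_UN)
    moreover have "(\<Union>n. \<Inter>k\<in>{n..}. space Q - A k) = space Q - limsup A"
      by (auto simp: limsup_INF_SUP)
    ultimately show ?thesis by simp
  qed
  ultimately show ?thesis
    unfolding mutually_singular_def using sets by (intro conjI bexI[of _ "limsup A"]) auto
qed

text \<open>Comparing only the total masses of a set generally loses Hellinger distance, because
  values of \<open>h\<close> above and below 1 can cancel. Here \<open>sqrt h\<close> stays on one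
  side of 1 at distance between \<open>a\<close> and \<open>2 * a\<close>. Thus
  \<open>sqrt l\<close> and \<open>sqrt m\<close> differ by at least \<open>a * sqrt m\<close>,
  while the integral is at most \<open>4 * a\<^sup>2 * m\<close>, whence the factor 4.\<close>

lemma hellinger_cell_bound:
  fixes a :: real
  assumes h: "h \<in> borel_measurable \<mu>" "\<And>x. x \<in> space \<mu> \<Longrightarrow> 0 \<le> h x"
    and \<Lambda>: "\<Lambda> = density \<mu> (\<lambda>x. ennreal (h x))"
    and B: "B \<in> sets \<mu>" "emeasure \<mu> B \<noteq> \<infinity>" "emeasure \<Lambda> B \<noteq> \<infinity>"
    and a: "0 \<le> a" "\<And>x. x \<in> B \<Longrightarrow> a \<le> \<bar>sqrt (h x) - 1\<bar>" "\<And>x. x \<in> B \<Longrightarrow> \<bar>sqrt (h x) - 1\<bar> \<le> 2 * a"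
    and side: "(\<forall>x\<in>B. 1 \<le> h x) \<or> (\<forall>x\<in>B. h x < 1)"
  shows "(\<integral>\<^sup>+x. ennreal ((sqrt (h x) - 1)\<^sup>2) * indicator B x \<partial>\<mu>) \<le>
    4 * ennreal ((sqrt (measure \<Lambda> B) - sqrt (measure \<mu> B))\<^sup>2)"
proof (cases "B = {}")
  case True
  then show ?thesis by simp
next
  case False
  note [measurable] = h(1) B(1)
  define l m where "l = measure \<Lambda> B" and "m = measure \<mu> B"
  have l: "emeasure \<Lambda> B = ennreal l" "0 \<le> l" and m: "emeasure \<mu> B = ennreal m" "0 \<le> m"
    using B by (simp_all add: l_def m_def emeasure_eq_ennreal_measure)
  have em: "ennreal l = (\<integral>\<^sup>+x. ennreal (h x) * indicator B x \<partial>\<mu>)"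
    unfolding l(1)[symmetric] \<Lambda> by (rule emeasure_density) auto
  have const: "(\<integral>\<^sup>+x. ennreal r * indicator B x \<partial>\<mu>) = ennreal (r * m)" if "0 \<le> r" for r
    using that m by (simp add: nn_integral_cmult ennreal_mult)
  have h0: "0 \<le> h x" if "x \<in> B" for x using that h(2) sets.sets_into_space[OF B(1)] by auto
  have "a * sqrt m \<le> \<bar>sqrt l - sqrt m\<bar>"
    using side
  proof
    assume s: "\<forall>x\<in>B. 1 \<le> h x"
    have "(1 + a)\<^sup>2 \<le> h x" if x: "x \<in> B" for x
    proof -
      have "1 \<le> sqrt (h x)" using s x by auto
      then have "1 + a \<le> sqrt (h x)" using a(2)[OF x] by auto
      then have "(1 + a)\<^sup>2 \<le> (sqrt (h x))\<^sup>2" using a(1) by (intro power_mono) auto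
      then show ?thesis using h0[OF x] by simp
    qed
    then have "(\<integral>\<^sup>+x. ennreal ((1 + a)\<^sup>2) * indicator B x \<partial>\<mu>) \<le> ennreal l"
      unfolding em by (intro nn_integral_mono) (auto simp: indicator_def intro!: ennreal_leI)
    then have "(1 + a)\<^sup>2 * m \<le> l" using l by (subst (asm) const) (auto simp: ennreal_le_iff)
    then have "sqrt ((1 + a)\<^sup>2 * m) \<le> sqrt l" by simp
    then show ?thesis using a(1) m by (simp add: real_sqrt_mult distrib_right)
  next
    assume s: "\<forall>x\<in>B. h x < 1"
    have *: "sqrt (h x) \<le> 1 - a" if x: "x \<in> B" for x
    proof -
      have "sqrt (h x) < 1" using s x by auto
      then show ?thesis using a(2)[OF x] by auto
    qed
    \<comment> \<open>A point of \<open>B\<close> is needed to see that \<open>1 - a\<close> is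
      nonnegative, so that it is the square root of its own square.\<close>
    obtain y where "y \<in> B" using False by auto
    then have a1: "0 \<le> 1 - a" using * h0 by (meson order_trans real_sqrt_ge_zero)
    have "h x \<le> (1 - a)\<^sup>2" if x: "x \<in> B" for x
    proof -
      have "(sqrt (h x))\<^sup>2 \<le> (1 - a)\<^sup>2" using *[OF x] h0[OF x] by (intro power_mono) auto
      then show ?thesis using h0[OF x] by simp
    qed
    then have "ennreal l \<le> (\<integral>\<^sup>+x. ennreal ((1 - a)\<^sup>2) * indicator B x \<partial>\<mu>)"
      unfolding em by (intro nn_integral_mono) (auto simp: indicator_def intro!: ennreal_leI)
    then have "l \<le> (1 - a)\<^sup>2 * m" using m by (subst (asm) const) (auto simp: ennreal_le_iff)
    then have "sqrt l \<le> sqrt ((1 - a)\<^sup>2 * m)" by simp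
    then show ?thesis using a1 m by (simp add: real_sqrt_mult left_diff_distrib)
  qed
  then have "(a * sqrt m)\<^sup>2 \<le> \<bar>sqrt l - sqrt m\<bar>\<^sup>2" using a(1) m by (intro power_mono) auto
  then have low: "a\<^sup>2 * m \<le> (sqrt l - sqrt m)\<^sup>2" using m by (simp add: power_mult_distrib)
  have "(sqrt (h x) - 1)\<^sup>2 \<le> (2 * a)\<^sup>2" if "x \<in> B" for x
    using power_mono[OF a(3)[OF that], of 2] by simp
  then have "(\<integral>\<^sup>+x. ennreal ((sqrt (h x) - 1)\<^sup>2) * indicator B x \<partial>\<mu>) \<le>
      (\<integral>\<^sup>+x. ennreal ((2 * a)\<^sup>2) * indicator B x \<partial>\<mu>)"
    by (intro nn_integral_mono) (auto simp: indicator_def intro!: ennreal_leI)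
  also have "\<dots> = ennreal (4 * (a\<^sup>2 * m))"
    by (subst const) (simp_all add: power_mult_distrib mult.assoc)
  also have "\<dots> \<le> ennreal (4 * (sqrt l - sqrt m)\<^sup>2)" using low by (intro ennreal_leI) simp
  also have "\<dots> = 4 * ennreal ((sqrt l - sqrt m)\<^sup>2)" by (subst ennreal_mult) auto
  finally show ?thesis by (simp add: l_def m_def)
qed

text \<open>The space is cut by the pieces of finite mass, by the dyadic level of
  \<open>\<bar>sqrt h - 1\<bar>\<close> and by the side of 1 on which \<open>h\<close> lies. By
  \<open>hellinger_cell_bound\<close> the infinite integral is at most 4 times the sum of the cell
  contributions, so the partial sums of the latter exceed every \<open>M\<close>.\<close>

lemma hellinger_finite_approximation:
  fixes M :: real
  assumes sf: "sigma_finite_measure \<Lambda>" "sigma_finite_measure \<mu>"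
    and h: "h \<in> borel_measurable \<mu>" "\<And>x. x \<in> space \<mu> \<Longrightarrow> 0 \<le> h x"
    and \<Lambda>: "\<Lambda> = density \<mu> (\<lambda>x. ennreal (h x))"
    and inf: "(\<integral>\<^sup>+x. ennreal ((sqrt (h x) - 1)\<^sup>2) \<partial>\<mu>) = \<infinity>"
  obtains C :: "nat \<Rightarrow> 'a set" and N :: nat where "disjoint_family C" "range C \<subseteq> sets \<mu>"
    "\<forall>n. emeasure \<Lambda> (C n) \<noteq> \<infinity>" "\<forall>n. emeasure \<mu> (C n) \<noteq> \<infinity>"
    "M < (\<Sum>n<N. (sqrt (measure \<Lambda> (C n)) - sqrt (measure \<mu> (C n)))\<^sup>2)"
proof -
  note [measurable] = h(1)
  have sets\<Lambda>: "sets \<Lambda> = sets \<mu>" by (simp add: \<Lambda>)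
  obtain D :: "nat \<Rightarrow> 'a set" where D: "disjoint_family D" "(\<Union>i. D i) = space \<mu>" "range D \<subseteq> sets \<mu>"
    "\<And>i. emeasure \<Lambda> (D i) \<noteq> \<infinity>" "\<And>i. emeasure \<mu> (D i) \<noteq> \<infinity>"
    using sigma_finite_common_partition[OF sf sets\<Lambda> refl] by blast
  have [measurable]: "D i \<in> sets \<mu>" for i using D(3) by auto
  define level where "level x = \<lfloor>log 2 \<bar>sqrt (h x) - 1\<bar>\<rfloor>" for x
  \<comment> \<open>Points with \<open>h x = 1\<close> have no dyadic level; they are left out,
    since the integrand vanishes there.\<close>
  define cell where "cell i k s = {x \<in> space \<mu>. x \<in> D i \<and> h x \<noteq> 1 \<and> level x = k \<and> (1 \<le> h x \<longleftrightarrow> s)}"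
    for i k s
  \<comment> \<open>The map \<open>from_nat\<close> may take the same value at several numbers. Only
    the canonical code of a triple receives its cell, the other numbers the empty set; otherwise
    \<open>C\<close> could repeat cells and fail to be disjoint.\<close>
  define C where "C n = (case from_nat n of (i, k, s) \<Rightarrow> if to_nat (i, k, s) = n then cell i k s else {})"
    for n
  have cell_meas: "cell i k s \<in> sets \<mu>" for i k s
    unfolding cell_def level_def by measurable
  have C_cases: "C n = {} \<or> (\<exists>i k s. n = to_nat (i, k, s) \<and> C n = cell i k s)" for n
    unfolding C_def by (cases "from_nat n :: nat \<times> int \<times> bool") auto
  have C_to_nat: "C (to_nat (i, k, s)) = cell i k s" for i k s
    by (simp add: C_def)
  have Cm [measurable]: "C n \<in> sets \<mu>" for n using C_cases[of n] cell_meas by auto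
  have dis: "disjoint_family C"
    unfolding disjoint_family_on_def
  proof (intro ballI impI equals0I)
    fix m n x assume mn: "m \<noteq> n" and "x \<in> C m \<inter> C n"
    then obtain i k s j k' s' where *: "m = to_nat (i, k, s)" "x \<in> cell i k s"
      "n = to_nat (j, k', s')" "x \<in> cell j k' s'"
      using C_cases[of m] C_cases[of n] by auto
    then have "x \<in> D i" "x \<in> D j" by (simp_all add: cell_def)
    then have "i = j" using D(1) unfolding disjoint_family_on_def by blast
    with * have "m = n" by (auto simp: cell_def)
    with mn show False by simp
  qed
  have fin: "emeasure \<Lambda> (C n) \<noteq> \<infinity>" "emeasure \<mu> (C n) \<noteq> \<infinity>" for n
  proof -
    have "\<exists>i. C n \<subseteq> D i" using C_cases[of n] unfolding cell_def by blast
    then obtain i where i: "C n \<subseteq> D i" by blast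
    have "emeasure \<Lambda> (C n) \<le> emeasure \<Lambda> (D i)" "emeasure \<mu> (C n) \<le> emeasure \<mu> (D i)"
      using i by (auto intro!: emeasure_mono simp: sets\<Lambda>)
    then show "emeasure \<Lambda> (C n) \<noteq> \<infinity>" "emeasure \<mu> (C n) \<noteq> \<infinity>"
      using D(4,5)[of i] by (auto simp: top_unique)
  qed
  define d where "d n = (sqrt (measure \<Lambda> (C n)) - sqrt (measure \<mu> (C n)))\<^sup>2" for n
  let ?G = "\<lambda>x. ennreal ((sqrt (h x) - 1)\<^sup>2)"
  have bound: "(\<integral>\<^sup>+x. ?G x * indicator (C n) x \<partial>\<mu>) \<le> 4 * ennreal (d n)" for n
  proof (cases "C n = {}")
    case True
    then show ?thesis by simp
  next
    case False
    then obtain i k s where C: "C n = cell i k s" using C_cases by blast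
    have lev: "2 powr k \<le> \<bar>sqrt (h x) - 1\<bar>" "\<bar>sqrt (h x) - 1\<bar> \<le> 2 * 2 powr k" if x: "x \<in> C n" for x
    proof -
      have "sqrt (h x) \<noteq> 1" using x by (simp add: C cell_def)
      then have pos: "0 < \<bar>sqrt (h x) - 1\<bar>" by simp
      have k: "\<lfloor>log 2 \<bar>sqrt (h x) - 1\<bar>\<rfloor> = k" using x by (simp add: C cell_def level_def)
      then have "of_int k \<le> log 2 \<bar>sqrt (h x) - 1\<bar>" by linarith
      then show "2 powr k \<le> \<bar>sqrt (h x) - 1\<bar>" using pos by (simp add: le_log_iff)
      have "log 2 \<bar>sqrt (h x) - 1\<bar> \<le> 1 + of_int k" using k by linarith
      then have "\<bar>sqrt (h x) - 1\<bar> \<le> 2 powr (1 + of_int k)" using pos by (simp add: log_le_iff)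
      then show "\<bar>sqrt (h x) - 1\<bar> \<le> 2 * 2 powr k" by (simp add: powr_add)
    qed
    have side: "(\<forall>x\<in>C n. 1 \<le> h x) \<or> (\<forall>x\<in>C n. h x < 1)"
      by (cases s) (auto simp: C cell_def)
    show ?thesis
      unfolding d_def by (rule hellinger_cell_bound[OF h \<Lambda> Cm fin(2,1) _ lev side]) auto
  qed
  have "\<infinity> = (\<integral>\<^sup>+x. (\<Sum>n. ?G x * indicator (C n) x) \<partial>\<mu>)"
    unfolding inf[symmetric]
  proof (rule nn_integral_cong)
    fix x assume x: "x \<in> space \<mu>"
    have "(\<Sum>n. ?G x * indicator (C n) x) = ?G x * indicator (\<Union>n. C n) x"
      by (simp add: suminf_indicator[OF dis])
    moreover have "x \<in> (\<Union>n. C n)" if "h x \<noteq> 1"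
    proof -
      obtain i where "x \<in> D i" using x D(2) by blast
      then have "x \<in> C (to_nat (i, level x, 1 \<le> h x))"
        using x \<open>h x \<noteq> 1\<close> by (simp only: C_to_nat) (simp add: cell_def)
      then show ?thesis by blast
    qed
    ultimately show "?G x = (\<Sum>n. ?G x * indicator (C n) x)" by (cases "h x = 1") auto
  qed
  also have "\<dots> = (\<Sum>n. \<integral>\<^sup>+x. ?G x * indicator (C n) x \<partial>\<mu>)"
    by (intro nn_integral_suminf) measurable
  also have "\<dots> \<le> (\<Sum>n. 4 * ennreal (d n))"
    by (intro suminf_le bound) auto
  also have "\<dots> = 4 * (\<Sum>n. ennreal (d n))" by simp
  finally have "(\<Sum>n. ennreal (d n)) = \<infinity>"
    by (auto simp: top_unique ennreal_mult_eq_top_iff)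
  then have "ennreal M < (SUP N. \<Sum>n<N. ennreal (d n))"
    by (simp add: suminf_eq_SUP[symmetric] less_top[symmetric])
  then obtain N where "ennreal M < (\<Sum>n<N. ennreal (d n))" by (auto simp: less_SUP_iff)
  also have "\<dots> = ennreal (\<Sum>n<N. d n)" by (intro sum_ennreal) (simp add: d_def)
  finally have "M < (\<Sum>n<N. d n)"
    by (metis ennreal_leI linorder_not_less)
  then show thesis
    using dis fin Cm unfolding d_def by (intro that[of C N]) auto
qed

lemma poisson_pp_mutually_singular:
  assumes P: "poisson_pp S \<Lambda> P" and Q: "poisson_pp S \<mu> Q" and \<mu>: "sets \<mu> = sets S"
    and sf: "sigma_finite_measure \<Lambda>" "sigma_finite_measure \<mu>"
    and ac: "absolutely_continuous \<Lambda> \<mu>"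
    and h: "h \<in> borel_measurable \<mu>" "\<And>x. x \<in> space \<mu> \<Longrightarrow> 0 \<le> h x"
    and \<Lambda>: "\<Lambda> = density \<mu> (\<lambda>x. ennreal (h x))"
    and inf: "(\<integral>\<^sup>+x. ennreal ((sqrt (h x) - 1)\<^sup>2) \<partial>\<mu>) = \<infinity>"
  shows "mutually_singular P Q"
proof (rule mutually_singularI)
  show "sets P = sets Q" using P Q by (simp add: poisson_pp_def)
  fix n :: nat
  \<comment> \<open>Chosen so that a sum above \<open>M\<close> pushes the affinity below
    \<open>exp (- M / 2) = (1/2) ^ n\<close>.\<close>
  define M where "M = 2 * (real n * ln 2)"
  have sets\<Lambda>: "sets \<Lambda> = sets \<mu>" by (simp add: \<Lambda>)
  have ac': "absolutely_continuous \<mu> \<Lambda>"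
    unfolding \<Lambda> using h(1) by (intro absolutely_continuousI_density) simp
  obtain C :: "nat \<Rightarrow> 'a set" and N :: nat where C: "disjoint_family C" "range C \<subseteq> sets \<mu>"
    "\<forall>n. emeasure \<Lambda> (C n) \<noteq> \<infinity>" "\<forall>n. emeasure \<mu> (C n) \<noteq> \<infinity>"
    "M < (\<Sum>n<N. (sqrt (measure \<Lambda> (C n)) - sqrt (measure \<mu> (C n)))\<^sup>2)"
    by (rule hellinger_finite_approximation[OF sf h \<Lambda> inf, of M])
  define l where "l i = measure \<Lambda> (C i)" for i
  define m where "m i = measure \<mu> (C i)" for i
  have em: "emeasure \<Lambda> (C i) = ennreal (l i)" "emeasure \<mu> (C i) = ennreal (m i)" for i
    using C(3,4) by (simp_all add: l_def m_def emeasure_eq_ennreal_measure)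
  have Cm: "C i \<in> sets \<mu>" for i using C(2) by auto
  have "C i \<in> null_sets \<Lambda> \<longleftrightarrow> C i \<in> null_sets \<mu>" for i
    using ac ac' by (auto simp: absolutely_continuous_def)
  moreover have "C i \<in> null_sets \<Lambda> \<longleftrightarrow> l i = 0" "C i \<in> null_sets \<mu> \<longleftrightarrow> m i = 0" for i
    using Cm[of i] sets\<Lambda> by (simp_all add: null_sets_def em) (simp_all add: l_def m_def measure_le_0_iff)
  ultimately have zero: "l i = 0 \<longleftrightarrow> m i = 0" for i by simp
  \<comment> \<open>The affinity formula needs positive rates. By mutual absolute continuity a cell
    null for one intensity is null for the other, so the dropped cells contribute 0 to the
    sum.\<close>
  define I where "I = {i. i < N \<and> m i \<noteq> 0}"
  have I: "finite I" by (simp add: I_def)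
  have pos: "0 < l i" "0 < m i" if "i \<in> I" for i
    using that zero[of i] by (auto simp: I_def l_def m_def zero_less_measure_iff)
  have "(\<Sum>i\<in>I. (sqrt (l i) - sqrt (m i))\<^sup>2) = (\<Sum>i<N. (sqrt (l i) - sqrt (m i))\<^sup>2)"
    using zero by (intro sum.mono_neutral_left) (auto simp: I_def)
  with C(5) have "M < (\<Sum>i\<in>I. (sqrt (l i) - sqrt (m i))\<^sup>2)" by (simp add: l_def m_def)
  then have "exp (- ((\<Sum>i\<in>I. (sqrt (l i) - sqrt (m i))\<^sup>2) / 2)) \<le> exp (- (real n * ln 2))"
    by (simp add: M_def)
  also have "\<dots> = (1 / 2) ^ n"
    using exp_of_nat_mult[of n "- ln 2 :: real"] by (simp add: exp_minus inverse_eq_divide)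
  finally have small: "ennreal (exp (- ((\<Sum>i\<in>I. (sqrt (l i) - sqrt (m i))\<^sup>2) / 2))) \<le> ennreal ((1 / 2) ^ n)"
    by (rule ennreal_leI)
  have CI: "C ` I \<subseteq> sets S" using Cm \<mu> by auto
  have dI: "disjoint_family_on C I" using C(1) by (rule disjoint_family_on_mono[rotated]) simp
  obtain A where "A \<in> sets P"
    "emeasure P A \<le> ennreal (exp (- ((\<Sum>i\<in>I. (sqrt (l i) - sqrt (m i))\<^sup>2) / 2)))"
    "emeasure Q (space Q - A) \<le> ennreal (exp (- ((\<Sum>i\<in>I. (sqrt (l i) - sqrt (m i))\<^sup>2) / 2)))"
    by (rule poisson_pp_separating_event[OF P Q I CI dI em pos])
  then show "\<exists>A\<in>sets P. emeasure P A \<le> ennreal ((1/2) ^ n) \<and> emeasure Q (space Q - A) \<le> ennreal ((1/2) ^ n)"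
    using small order_trans by blast
qed

text \<open>The measure \<mu> itself serves as dominating measure, with density 1. The symmetry lets
  the two processes exchange roles.\<close>

lemma hellinger_density:
  assumes \<mu>: "sigma_finite_measure \<mu>" and h: "is_density \<mu> \<Lambda> h"
  shows "hellinger \<Lambda> \<mu> = ennreal_sqrt (1 / 2 * (\<integral>\<^sup>+x. ennreal ((sqrt (h x) - 1)\<^sup>2) \<partial>\<mu>))"
    and "hellinger \<mu> \<Lambda> = hellinger \<Lambda> \<mu>"
proof -
  have 1: "is_density \<mu> \<mu> (\<lambda>_. 1)" by (simp add: is_density_def density_1)
  show "hellinger \<Lambda> \<mu> = ennreal_sqrt (1 / 2 * (\<integral>\<^sup>+x. ennreal ((sqrt (h x) - 1)\<^sup>2) \<partial>\<mu>))"
    unfolding hellinger_eq[OF \<mu> h 1] by (simp add: hellinger_via_def)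
  show "hellinger \<mu> \<Lambda> = hellinger \<Lambda> \<mu>"
    unfolding hellinger_eq[OF \<mu> h 1] hellinger_eq[OF \<mu> 1 h]
    by (simp add: hellinger_via_def power2_commute)
qed

lemma ennreal_sqrt_eq_top_iff: "ennreal_sqrt x = \<infinity> \<longleftrightarrow> x = \<infinity>"
  by (simp add: ennreal_sqrt_def)

lemma hellinger_eq_top_iff:
  assumes "sigma_finite_measure \<mu>" "is_density \<mu> \<Lambda> h"
  shows "hellinger \<Lambda> \<mu> = \<infinity> \<longleftrightarrow> (\<integral>\<^sup>+x. ennreal ((sqrt (h x) - 1)\<^sup>2) \<partial>\<mu>) = \<infinity>"
proof -
  have "(1 / 2 :: ennreal) \<noteq> 0" by (simp add: ennreal_divide_eq_0_iff)
  moreover have "(1 / 2 :: ennreal) \<noteq> top" by (simp add: ennreal_divide_eq_top_iff)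
  ultimately show ?thesis
    unfolding hellinger_density(1)[OF assms] ennreal_sqrt_eq_top_iff
    by (simp add: ennreal_mult_eq_top_iff)
qed

text \<open>The density \<open>h\<close> is chosen inside the proof, so that the result can be
  applied in both directions, each with its own density.\<close>

lemma poisson_pp_absolutely_continuous_hellinger:
  assumes P: "poisson_pp S \<Lambda> P" and Q: "poisson_pp S \<mu> Q"
    and sets: "sets \<Lambda> = sets S" "sets \<mu> = sets S"
    and sf: "sigma_finite_measure \<Lambda>" "sigma_finite_measure \<mu>"
    and ac: "absolutely_continuous \<mu> \<Lambda>" and fin: "hellinger \<Lambda> \<mu> < \<infinity>"
  shows "absolutely_continuous Q P"
proof -
  obtain h where h: "is_density \<mu> \<Lambda> h"
    using is_density_exists[OF sf(2,1) _ ac] sets by auto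
  have "(\<integral>\<^sup>+x. ennreal ((sqrt (h x) - 1)\<^sup>2) \<partial>\<mu>) < \<infinity>"
    using fin hellinger_eq_top_iff[OF sf(2) h] unfolding infinity_ennreal_def top.not_eq_extremum[symmetric]
    by blast
  then show ?thesis
    using h by (intro poisson_pp_absolutely_continuous[OF P Q sets(2) sf, of h]) (auto simp: is_density_def)
qed

theorem theorem5p6:
  fixes S \<Lambda> \<mu> :: "'a measure" and P\<^sub>\<Lambda> P\<^sub>\<mu> :: "'a measure measure"
  assumes "sets \<Lambda> = sets S" and "sets \<mu> = sets S"
    and "sigma_finite_measure \<Lambda>" and "sigma_finite_measure \<mu>"
    and "absolutely_continuous \<mu> \<Lambda>" and "absolutely_continuous \<Lambda> \<mu>"
    and "poisson_pp S \<Lambda> P\<^sub>\<Lambda>" and "poisson_pp S \<mu> P\<^sub>\<mu>"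
  shows "(hellinger \<Lambda> \<mu> < \<infinity> \<longrightarrow>
            absolutely_continuous P\<^sub>\<mu> P\<^sub>\<Lambda> \<and> absolutely_continuous P\<^sub>\<Lambda> P\<^sub>\<mu>) \<and>
         (hellinger \<Lambda> \<mu> = \<infinity> \<longrightarrow> mutually_singular P\<^sub>\<Lambda> P\<^sub>\<mu>)"
proof -
  obtain h where h: "is_density \<mu> \<Lambda> h"
    using is_density_exists[OF assms(4,3) _ assms(5)] assms(1,2) by auto
  have "absolutely_continuous P\<^sub>\<mu> P\<^sub>\<Lambda> \<and> absolutely_continuous P\<^sub>\<Lambda> P\<^sub>\<mu>" if fin: "hellinger \<Lambda> \<mu> < \<infinity>"
  proof
    show "absolutely_continuous P\<^sub>\<mu> P\<^sub>\<Lambda>"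
      by (rule poisson_pp_absolutely_continuous_hellinger[OF assms(7,8,1,2,3,4,5) fin])
    have "hellinger \<mu> \<Lambda> < \<infinity>" using fin hellinger_density(2)[OF assms(4) h] by simp
    then show "absolutely_continuous P\<^sub>\<Lambda> P\<^sub>\<mu>"
      by (rule poisson_pp_absolutely_continuous_hellinger[OF assms(8,7,2,1,4,3,6)])
  qed
  moreover have "mutually_singular P\<^sub>\<Lambda> P\<^sub>\<mu>" if "hellinger \<Lambda> \<mu> = \<infinity>"
  proof (rule poisson_pp_mutually_singular[OF assms(7,8,2,3,4,6)])
    show "(\<integral>\<^sup>+x. ennreal ((sqrt (h x) - 1)\<^sup>2) \<partial>\<mu>) = \<infinity>"
      using that hellinger_eq_top_iff[OF assms(4) h] by simp
  qed (use h in \<open>auto simp: is_density_def\<close>)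
  ultimately show ?thesis by blast
qed

end
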